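(* Let $A_1,A_2\in\mathbb{R}^{n\times n}$, $e_1,e_2\in\mathbb{R}^n$, $c\in\mathbb{R}^n$ with $c\neq0$, and $f\in\mathbb{R}$, and consider the bimodal piecewise affine system determined by these data (see context). Suppose that the observability indices $h_1$ of $(c^T,A_1)$ and $h_2$ of $(c^T,A_2)$ are the same, and let $h=h_1=h_2$. If there exists an $(h+2)\times(h+2)$ lower triangular matrix $M$ with positive diagonal elements such that $$\begin{bmatrix}c^T\\ c^TA_1\\ \vdots\\ c^TA_1^{h+1}\end{bmatrix}=M\begin{bmatrix}c^T\\ c^TA_2\\ \vdots\\ c^TA_2^{h+1}\end{bmatrix},\qquad \begin{bmatrix}f\\ c^Te_1\\ \vdots\\ c^TA_1^{h}e_1\end{bmatrix}= M\begin{bmatrix}f\\ c^Te_2\\ \vdots\\ c^TA_2^{h}e_2\end{bmatrix},$$ and the implication $$\begin{bmatrix}c^T\\ c^TA_1\\ \vdots\\ c^TA_1^{h+1}\end{bmatrix}\xi+\begin{bmatrix}f\\ c^Te_1\\ \vdots\\ c^TA_1^{h}e_1\end{bmatrix}=0\ \Rightarrow\ A_1\xi+e_1=A_2\xi+e_2$$ holds for all $\xi\in\mathbb{R}^n$, then the system is Zeno-free.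
   Context: Define the set-valued mapping $G(x)=\{A_1x+e_1\}$ if $c^Tx+f<0$, $G(x)=\operatorname{conv}\{A_1x+e_1,A_2x+e_2\}$ if $c^Tx+f=0$, $G(x)=\{A_2x+e_2\}$ if $c^Tx+f>0$. A function $x:\mathbb{R}\to\mathbb{R}^n$, absolutely continuous on every compact interval, is a Filippov solution for the initial state $\xi$ if $x(0)=\xi$ and $\dot x(t)\in G(x(t))$ for almost all $t\in\mathbb{R}$. The observability index $h_i$ of $(c^T,A_i)$ is the largest integer such that the matrix with rows $c^T,c^TA_i,\dots,c^TA_i^{h_i}$ has full row rank. A time instant $t^*\in\mathbb{R}$ is a non-switching time for a Filippov solution $x$ if there exist $\epsilon>0$ and an index $i\in\{1,2\}$ such that $\dot x(t)=A_ix(t)+e_i$ and $(-1)^{i-1}[c^Tx(t)+f]\leq0$ for all $t\in(t^*-\epsilon,t^*+\epsilon)$; otherwise $t^*$ is a switching time for $x$. A time instant $t^*$ is a left (respectively right) Zeno time for $x$ if for each $\epsilon>0$ the interval $(t^*,t^*+\epsilon)$ (respectively $(t^*-\epsilon,t^* )$) contains a switching time for $x$. A Filippov solution is left (right) Zeno-free if there exists no left (right) Zeno time for it. The system is left (right) Zeno-free if all its Filippov solutions (for all initial states) are left (right) Zeno-free, and it is Zeno-free if it is both left and right Zeno-free. *)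

theory Defs
  imports "HOL-Analysis.Analysis"
begin

text \<open>
  Matrix powers: \<open>*\<close> and \<open>^\<close> act componentwise on the type of matrices, so the power with
  respect to \<open>**\<close> has to be introduced.
\<close>

primrec matpow :: "real^'n^'n \<Rightarrow> nat \<Rightarrow> real^'n^'n" where
  "matpow A 0 = mat 1"
| "matpow A (Suc k) = matpow A k ** A"

definition obs_row :: "real^'n \<Rightarrow> real^'n^'n \<Rightarrow> nat \<Rightarrow> real^'n" where
  "obs_row c A k = c v* matpow A k"

text \<open>The entries of the column \<open>(f, c\<^sup>T e, c\<^sup>T A e, c\<^sup>T A\<^sup>2 e, ...)\<close>.\<close>

definition obs_offset :: "real \<Rightarrow> real^'n \<Rightarrow> real^'n^'n \<Rightarrow> real^'n \<Rightarrow> nat \<Rightarrow> real" where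
  "obs_offset f c A e k = (case k of 0 \<Rightarrow> f | Suc j \<Rightarrow> obs_row c A j \<bullet> e)"

text \<open>
  The number of rows varies, so the matrix with rows \<open>c\<^sup>T, ..., c\<^sup>T A\<^sup>k\<close> is given by its
  family of rows; its rank is the dimension of the row space, as in \<open>row_rank_def\<close>.
\<close>

definition full_row_rank :: "real^'n \<Rightarrow> real^'n^'n \<Rightarrow> nat \<Rightarrow> bool" where
  "full_row_rank c A k \<longleftrightarrow> dim (obs_row c A ` {..k}) = k + 1"

definition observability_index :: "real^'n \<Rightarrow> real^'n^'n \<Rightarrow> nat" where
  "observability_index c A = (GREATEST k. full_row_rank c A k)"

text \<open>The maximum exists whenever \<open>c \<noteq> 0\<close>:\<close>

lemma full_row_rank_less_CARD:
  fixes c :: "real^'n"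
  assumes "full_row_rank c A k"
  shows "k < CARD('n)"
proof -
  have "dim (obs_row c A ` {..k}) \<le> DIM(real^'n)"
    by (rule dim_subset_UNIV)
  then show ?thesis
    using assms by (simp add: full_row_rank_def)
qed

lemma observability_index:
  assumes "c \<noteq> 0"
  shows "full_row_rank c A (observability_index c A)"
    and "full_row_rank c A k \<Longrightarrow> k \<le> observability_index c A"
proof -
  have bound: "\<And>k. full_row_rank c A k \<Longrightarrow> k \<le> CARD('a)"
    using full_row_rank_less_CARD less_imp_le by blast
  have "full_row_rank c A 0"
    using assms by (simp add: full_row_rank_def obs_row_def dim_insert)
  then show "full_row_rank c A (observability_index c A)"
    unfolding observability_index_def using bound by (rule GreatestI_nat)
  show "k \<le> observability_index c A" if "full_row_rank c A k"
    unfolding observability_index_def using that bound by (rule Greatest_le_nat)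
qed

text \<open>Square matrices whose size is not fixed by a type: \<open>M i j\<close> with \<open>i, j < m\<close>.\<close>

definition lower_triangular :: "nat \<Rightarrow> (nat \<Rightarrow> nat \<Rightarrow> real) \<Rightarrow> bool" where
  "lower_triangular m M \<longleftrightarrow> (\<forall>i<m. \<forall>j<m. i < j \<longrightarrow> M i j = 0)"

text \<open>
  A pair \<open>(u, v)\<close> stands for the subinterval with endpoints \<open>u \<le> v\<close>; distinct subintervals
  may share endpoints.
\<close>

definition absolutely_continuous_on_interval ::
  "real \<Rightarrow> real \<Rightarrow> (real \<Rightarrow> 'a::real_normed_vector) \<Rightarrow> bool" where
  "absolutely_continuous_on_interval a b x \<longleftrightarrow>
     (\<forall>\<epsilon>>0. \<exists>\<delta>>0. \<forall>D. finite D \<and> (\<forall>(u, v)\<in>D. a \<le> u \<and> u \<le> v \<and> v \<le> b) \<and>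
        disjoint_family_on (\<lambda>(u, v). {u<..<v}) D \<and> (\<Sum>(u, v)\<in>D. v - u) < \<delta> \<longrightarrow>
        (\<Sum>(u, v)\<in>D. norm (x v - x u)) < \<epsilon>)"

definition G ::
  "real^'n^'n \<Rightarrow> real^'n^'n \<Rightarrow> real^'n \<Rightarrow> real^'n \<Rightarrow> real^'n \<Rightarrow> real \<Rightarrow> real^'n \<Rightarrow> (real^'n) set" where
  "G A1 A2 e1 e2 c f x =
     (if c \<bullet> x + f < 0 then {A1 *v x + e1}
      else if c \<bullet> x + f = 0 then convex hull {A1 *v x + e1, A2 *v x + e2}
      else {A2 *v x + e2})"

definition filippov_solution ::
  "real^'n^'n \<Rightarrow> real^'n^'n \<Rightarrow> real^'n \<Rightarrow> real^'n \<Rightarrow> real^'n \<Rightarrow> real \<Rightarrow>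
   real^'n \<Rightarrow> (real \<Rightarrow> real^'n) \<Rightarrow> bool" where
  "filippov_solution A1 A2 e1 e2 c f \<xi> x \<longleftrightarrow>
     (\<forall>a b. absolutely_continuous_on_interval a b x) \<and> x 0 = \<xi> \<and>
     (AE t in lebesgue. \<exists>v \<in> G A1 A2 e1 e2 c f (x t). (x has_vector_derivative v) (at t))"

definition non_switching_time ::
  "real^'n^'n \<Rightarrow> real^'n^'n \<Rightarrow> real^'n \<Rightarrow> real^'n \<Rightarrow> real^'n \<Rightarrow> real \<Rightarrow>
   (real \<Rightarrow> real^'n) \<Rightarrow> real \<Rightarrow> bool" where
  "non_switching_time A1 A2 e1 e2 c f x s \<longleftrightarrow>
     (\<exists>\<epsilon>>0.
        (\<forall>t\<in>{s - \<epsilon><..<s + \<epsilon>}.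
           (x has_vector_derivative A1 *v x t + e1) (at t) \<and> c \<bullet> x t + f \<le> 0) \<or>
        (\<forall>t\<in>{s - \<epsilon><..<s + \<epsilon>}.
           (x has_vector_derivative A2 *v x t + e2) (at t) \<and> - (c \<bullet> x t + f) \<le> 0))"

abbreviation switching_time ::
  "real^'n^'n \<Rightarrow> real^'n^'n \<Rightarrow> real^'n \<Rightarrow> real^'n \<Rightarrow> real^'n \<Rightarrow> real \<Rightarrow>
   (real \<Rightarrow> real^'n) \<Rightarrow> real \<Rightarrow> bool" where
  "switching_time A1 A2 e1 e2 c f x s \<equiv> \<not> non_switching_time A1 A2 e1 e2 c f x s"

definition left_Zeno_time ::
  "real^'n^'n \<Rightarrow> real^'n^'n \<Rightarrow> real^'n \<Rightarrow> real^'n \<Rightarrow> real^'n \<Rightarrow> real \<Rightarrow>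
   (real \<Rightarrow> real^'n) \<Rightarrow> real \<Rightarrow> bool" where
  "left_Zeno_time A1 A2 e1 e2 c f x s \<longleftrightarrow>
     (\<forall>\<epsilon>>0. \<exists>t\<in>{s<..<s + \<epsilon>}. switching_time A1 A2 e1 e2 c f x t)"

definition right_Zeno_time ::
  "real^'n^'n \<Rightarrow> real^'n^'n \<Rightarrow> real^'n \<Rightarrow> real^'n \<Rightarrow> real^'n \<Rightarrow> real \<Rightarrow>
   (real \<Rightarrow> real^'n) \<Rightarrow> real \<Rightarrow> bool" where
  "right_Zeno_time A1 A2 e1 e2 c f x s \<longleftrightarrow>
     (\<forall>\<epsilon>>0. \<exists>t\<in>{s - \<epsilon><..<s}. switching_time A1 A2 e1 e2 c f x t)"

definition left_Zeno_free ::
  "real^'n^'n \<Rightarrow> real^'n^'n \<Rightarrow> real^'n \<Rightarrow> real^'n \<Rightarrow> real^'n \<Rightarrow> real \<Rightarrow> bool" where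
  "left_Zeno_free A1 A2 e1 e2 c f \<longleftrightarrow>
     (\<forall>\<xi> x. filippov_solution A1 A2 e1 e2 c f \<xi> x \<longrightarrow>
        \<not> (\<exists>s. left_Zeno_time A1 A2 e1 e2 c f x s))"

definition right_Zeno_free ::
  "real^'n^'n \<Rightarrow> real^'n^'n \<Rightarrow> real^'n \<Rightarrow> real^'n \<Rightarrow> real^'n \<Rightarrow> real \<Rightarrow> bool" where
  "right_Zeno_free A1 A2 e1 e2 c f \<longleftrightarrow>
     (\<forall>\<xi> x. filippov_solution A1 A2 e1 e2 c f \<xi> x \<longrightarrow>
        \<not> (\<exists>s. right_Zeno_time A1 A2 e1 e2 c f x s))"

definition Zeno_free ::
  "real^'n^'n \<Rightarrow> real^'n^'n \<Rightarrow> real^'n \<Rightarrow> real^'n \<Rightarrow> real^'n \<Rightarrow> real \<Rightarrow> bool" where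
  "Zeno_free A1 A2 e1 e2 c f \<longleftrightarrow>
     left_Zeno_free A1 A2 e1 e2 c f \<and> right_Zeno_free A1 A2 e1 e2 c f"

end

theory Submission
  imports Defs
begin

text \<open>
  Along a Filippov solution let \<open>z\<^sub>j = c\<^sup>T A\<^sub>2\<^sup>j x + \<dots>\<close> (\<open>j \<le> h + 1\<close>) be the successive derivatives
  of \<open>z\<^sub>0 = c\<^sup>T x + f\<close> along the second mode. Triangularity and positivity of \<open>M\<close> make the
  derivative of \<open>z\<^sub>j\<close> along the first mode, hence along every convex combination of the modes, equal to
  a positive multiple of \<open>z\<^sub>j\<^sub>+\<^sub>1\<close> up to an error bounded by a
  multiple of \<open>\<bar>z\<^sub>0\<bar> + \<dots> + \<bar>z\<^sub>j\<bar>\<close>. If \<open>z\<^sub>k\<close> is the first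
  of these functions that does not vanish at \<open>s\<close>, then \<open>z\<^sub>j(t)\<close>, \<open>j \<le> k\<close>, is of exact order
  \<open>(t - s)\<^sup>k\<^sup>-\<^sup>j\<close> to the right of \<open>s\<close>, so \<open>z\<^sub>0\<close> has a constant sign there. If all vanish at \<open>s\<close>,
  then, since \<open>c\<^sup>T A\<^sub>2\<^sup>h\<^sup>+\<^sup>1\<close> is a linear combination of the previous rows, \<open>\<bar>z\<^sub>h\<^sub>+\<^sub>1\<bar>\<close> is bounded by a
  multiple of \<open>\<bar>z\<^sub>0\<bar> + \<dots> + \<bar>z\<^sub>h\<bar>\<close>, a Gronwall argument shows that all \<open>z\<^sub>j\<close> vanish near \<open>s\<close>, and there
  the two modes agree.
\<close>

section \<open>Absolutely continuous functions\<close>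

text \<open>Covers the closure properties used later: negation and affine images take
  \<open>L = 0\<close>, and subtraction of a Lipschitz function puts its Lipschitz constant into
  \<open>L\<close>. Each of the two terms receives half of \<open>\<epsilon>\<close>.\<close>

lemma absolutely_continuous_dominated:
  fixes f :: "real \<Rightarrow> 'a::real_normed_vector" and g :: "real \<Rightarrow> 'b::real_normed_vector"
  assumes ac: "absolutely_continuous_on_interval a b f"
    and K: "K \<ge> 0" and L: "L \<ge> 0"
    and le: "\<And>u v. \<lbrakk>a \<le> u; u \<le> v; v \<le> b\<rbrakk> \<Longrightarrow> norm (g v - g u) \<le> K * norm (f v - f u) + L * (v - u)"
  shows "absolutely_continuous_on_interval a b g"
  unfolding absolutely_continuous_on_interval_def
proof (intro allI impI)
  fix \<epsilon> :: real assume e: "\<epsilon> > 0"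
  define \<eta> where "\<eta> = \<epsilon> / (2 * (K + 1))"
  have eta: "\<eta> > 0" using e K by (simp add: \<eta>_def)
  obtain \<delta> where d: "\<delta> > 0" and
    D: "\<And>D. \<lbrakk>finite D; \<forall>(u, v)\<in>D. a \<le> u \<and> u \<le> v \<and> v \<le> b;
        disjoint_family_on (\<lambda>(u, v). {u<..<v}) D; (\<Sum>(u, v)\<in>D. v - u) < \<delta>\<rbrakk> \<Longrightarrow>
        (\<Sum>(u, v)\<in>D. norm (f v - f u)) < \<eta>"
    using ac eta unfolding absolutely_continuous_on_interval_def by meson
  define \<delta>' where "\<delta>' = min \<delta> (\<epsilon> / (2 * (L + 1)))"
  show "\<exists>\<delta>>0. \<forall>D. finite D \<and> (\<forall>(u, v)\<in>D. a \<le> u \<and> u \<le> v \<and> v \<le> b) \<and>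
        disjoint_family_on (\<lambda>(u, v). {u<..<v}) D \<and> (\<Sum>(u, v)\<in>D. v - u) < \<delta> \<longrightarrow>
        (\<Sum>(u, v)\<in>D. norm (g v - g u)) < \<epsilon>"
  proof (intro exI conjI allI impI)
    show "\<delta>' > 0" using d e L by (simp add: \<delta>'_def)
  next
    fix D :: "(real \<times> real) set"
    assume A: "finite D \<and> (\<forall>(u, v)\<in>D. a \<le> u \<and> u \<le> v \<and> v \<le> b) \<and>
        disjoint_family_on (\<lambda>(u, v). {u<..<v}) D \<and> (\<Sum>(u, v)\<in>D. v - u) < \<delta>'"
    have small: "(\<Sum>(u, v)\<in>D. norm (f v - f u)) < \<eta>"
      by (rule D) (use A in \<open>auto simp: \<delta>'_def\<close>)
    have "(\<Sum>(u, v)\<in>D. norm (g v - g u)) \<le> (\<Sum>(u, v)\<in>D. K * norm (f v - f u) + L * (v - u))"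
      by (rule sum_mono) (use A le in auto)
    also have "\<dots> = K * (\<Sum>(u, v)\<in>D. norm (f v - f u)) + L * (\<Sum>(u, v)\<in>D. v - u)"
      by (simp add: sum_distrib_left sum.distrib case_prod_beta)
    also have "\<dots> \<le> K * \<eta> + L * (\<epsilon> / (2 * (L + 1)))"
      by (intro add_mono mult_left_mono) (use small A K L in \<open>auto simp: \<delta>'_def\<close>)
    also have "\<dots> < \<epsilon> / 2 + \<epsilon> / 2"
      by (intro add_strict_mono) (use e K L in \<open>auto simp: \<eta>_def field_simps\<close>)
    finally show "(\<Sum>(u, v)\<in>D. norm (g v - g u)) < \<epsilon>" by simp
  qed
qed

lemma absolutely_continuous_imp_continuous_on:
  assumes ac: "absolutely_continuous_on_interval a b f"
  shows "continuous_on {a..b} f"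
  unfolding continuous_on_iff
proof (intro ballI allI impI)
  fix x and \<epsilon> :: real assume x: "x \<in> {a..b}" and e: "\<epsilon> > 0"
  obtain \<delta> where d: "\<delta> > 0" and
    D: "\<And>D. \<lbrakk>finite D; \<forall>(u, v)\<in>D. a \<le> u \<and> u \<le> v \<and> v \<le> b;
        disjoint_family_on (\<lambda>(u, v). {u<..<v}) D; (\<Sum>(u, v)\<in>D. v - u) < \<delta>\<rbrakk> \<Longrightarrow>
        (\<Sum>(u, v)\<in>D. norm (f v - f u)) < \<epsilon>"
    using ac e unfolding absolutely_continuous_on_interval_def by meson
  have "dist (f y) (f x) < \<epsilon>" if "y \<in> {a..b}" "dist y x < \<delta>" for y
    using D[of "{(min x y, max x y)}"] that x
    by (cases "x \<le> y") (auto simp: disjoint_family_on_def dist_norm min_def max_def norm_minus_commute)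
  then show "\<exists>d>0. \<forall>x'\<in>{a..b}. dist x' x < d \<longrightarrow> dist (f x') (f x) < \<epsilon>" using d by blast
qed

text \<open>The map \<open>(u, v) \<mapsto> (- v, - u)\<close> carries disjoint families of
  subintervals of \<open>{a..b}\<close> to such families in \<open>{- b..- a}\<close>, preserving
  lengths and the size of the increments.\<close>

lemma absolutely_continuous_reflect:
  assumes ac: "absolutely_continuous_on_interval (- b) (- a) f"
  shows "absolutely_continuous_on_interval a b (\<lambda>t. f (- t))"
  unfolding absolutely_continuous_on_interval_def
proof (intro allI impI)
  fix \<epsilon> :: real assume e: "\<epsilon> > 0"
  obtain \<delta> where d: "\<delta> > 0" and
    D: "\<And>D. \<lbrakk>finite D; \<forall>(u, v)\<in>D. - b \<le> u \<and> u \<le> v \<and> v \<le> - a;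
        disjoint_family_on (\<lambda>(u, v). {u<..<v}) D; (\<Sum>(u, v)\<in>D. v - u) < \<delta>\<rbrakk> \<Longrightarrow>
        (\<Sum>(u, v)\<in>D. norm (f v - f u)) < \<epsilon>"
    using ac e unfolding absolutely_continuous_on_interval_def by meson
  have "(\<Sum>(u, v)\<in>D. norm (f (- v) - f (- u))) < \<epsilon>"
    if A: "finite D" "\<forall>(u, v)\<in>D. a \<le> u \<and> u \<le> v \<and> v \<le> b"
        "disjoint_family_on (\<lambda>(u, v). {u<..<v}) D" "(\<Sum>(u, v)\<in>D. v - u) < \<delta>" for D
  proof -
    define r where "r = (\<lambda>(u::real, v::real). (- v, - u))"
    have inj: "inj_on r D" by (auto simp: inj_on_def r_def)
    have *: "(\<Sum>(u, v)\<in>r ` D. norm (f v - f u)) < \<epsilon>"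
    proof (rule D)
      show "disjoint_family_on (\<lambda>(u, v). {u<..<v}) (r ` D)"
        unfolding disjoint_family_on_def
      proof (intro ballI impI)
        fix P Q assume "P \<in> r ` D" "Q \<in> r ` D" "P \<noteq> Q"
        then obtain u v u' v' where PQ: "P = (- v, - u)" "Q = (- v', - u')"
          and "(u, v) \<in> D" "(u', v') \<in> D" "(u, v) \<noteq> (u', v')"
          by (auto simp: r_def)
        then have "{u<..<v} \<inter> {u'<..<v'} = {}"
          using A(3) unfolding disjoint_family_on_def by fastforce
        then have "uminus ` ({u<..<v} \<inter> {u'<..<v'}) = {}" by simp
        then show "(case P of (u, v) \<Rightarrow> {u<..<v}) \<inter> (case Q of (u, v) \<Rightarrow> {u<..<v}) = {}"
          by (simp add: image_Int PQ)
      qed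
      show "(\<Sum>(u, v)\<in>r ` D. v - u) < \<delta>"
        using A(4) inj by (simp add: sum.reindex) (simp add: r_def case_prod_beta)
    qed (use A in \<open>auto simp: r_def\<close>)
    then show ?thesis
      using inj by (simp add: sum.reindex) (simp add: r_def case_prod_beta norm_minus_commute)
  qed
  then show "\<exists>\<delta>>0. \<forall>D. finite D \<and> (\<forall>(u, v)\<in>D. a \<le> u \<and> u \<le> v \<and> v \<le> b) \<and>
        disjoint_family_on (\<lambda>(u, v). {u<..<v}) D \<and> (\<Sum>(u, v)\<in>D. v - u) < \<delta> \<longrightarrow>
        (\<Sum>(u, v)\<in>D. norm (f (- v) - f (- u))) < \<epsilon>"
    using d by blast
qed

section \<open>Monotonicity from an almost everywhere nonnegative derivative\<close>

lemma negligible_outer_open: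
  fixes N :: "'a::euclidean_space set"
  assumes "negligible N" "\<delta> > 0"
  obtains U where "open U" "N \<subseteq> U" "U \<in> lmeasurable" "measure lebesgue U < \<delta>"
proof -
  have N: "N \<in> null_sets lebesgue" using assms by (simp add: negligible_iff_null_sets)
  obtain U where U: "open U" "N \<subseteq> U" "(U - N) \<in> lmeasurable" "emeasure lebesgue (U - N) < ennreal \<delta>"
    using sets_lebesgue_outer_open N assms(2) by blast
  \<comment> \<open>Outer regularity bounds the measure of \<open>U - N\<close>; adding the null set
    \<open>N\<close> back does not change it.\<close>
  have "emeasure lebesgue U = emeasure lebesgue (U - N)"
    using N U by (simp add: emeasure_Diff_null_set)
  then have "emeasure lebesgue U < ennreal \<delta>" using U by simp
  moreover from this have "U \<in> lmeasurable"
    using U(1) by (intro fmeasurableI) (auto intro: order_less_trans)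
  ultimately show ?thesis
    using that U assms(2) by (auto simp: emeasure_eq_measure2 ennreal_less_iff)
qed

text \<open>
  The exceptional set is covered by an open set of small measure; a tagged division that is fine
  for a gauge confined to this set at exceptional tags (and given by the derivative at the other
  tags) splits into intervals of small total length and intervals where \<open>f\<close> almost increases.
\<close>

lemma absolutely_continuous_mono:
  fixes f :: "real \<Rightarrow> real"
  assumes ac: "absolutely_continuous_on_interval a b f" and ab: "a \<le> b"
    and N: "negligible N"
    and der: "\<And>t. t \<in> {a..b} - N \<Longrightarrow> \<exists>d\<ge>0. (f has_real_derivative d) (at t)"
  shows "f a \<le> f b"
proof -
  have "f a - f b \<le> 0 + \<epsilon>" if e: "\<epsilon> > 0" for \<epsilon>
  proof -
    \<comment> \<open>Tags outside \<open>N\<close> will cost at most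
      \<open>\<eta> * (b - a)\<close> and tags in \<open>N\<close> at most \<open>\<eta>\<close>,
      together \<open>\<epsilon>\<close>.\<close>
    define \<eta> where "\<eta> = \<epsilon> / (b - a + 1)"
    have eta: "\<eta> > 0" "\<eta> * (b - a) + \<eta> = \<epsilon>"
    proof -
      have "\<eta> * (b - a + 1) = \<epsilon>" using ab by (simp add: \<eta>_def)
      then show "\<eta> * (b - a) + \<eta> = \<epsilon>" by (simp add: distrib_left)
    qed (use e ab in \<open>simp add: \<eta>_def\<close>)
    obtain \<delta> where d: "\<delta> > 0" and
      D: "\<And>D. \<lbrakk>finite D; \<forall>(u, v)\<in>D. a \<le> u \<and> u \<le> v \<and> v \<le> b;
        disjoint_family_on (\<lambda>(u, v). {u<..<v}) D; (\<Sum>(u, v)\<in>D. v - u) < \<delta>\<rbrakk> \<Longrightarrow>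
        (\<Sum>(u, v)\<in>D. norm (f v - f u)) < \<eta>"
      using ac eta unfolding absolutely_continuous_on_interval_def by meson
    obtain U where U: "open U" "N \<subseteq> U" "U \<in> lmeasurable" "measure lebesgue U < \<delta>"
      using negligible_outer_open[OF N d] by blast
    have "\<exists>r>0. \<forall>u v. u \<le> t \<longrightarrow> t \<le> v \<longrightarrow> u \<in> ball t r \<longrightarrow> v \<in> ball t r \<longrightarrow> f u - f v \<le> \<eta> * (v - u)"
      if t: "t \<in> {a..b} - N" for t
    proof -
      obtain d where d: "d \<ge> 0" "(f has_derivative (\<lambda>h. d * h)) (at t)"
        using der[OF t] by (auto simp: has_field_derivative_def)
      then obtain r where r: "r > 0" "\<And>y. norm (y - t) < r \<Longrightarrow> norm (f y - f t - d * (y - t)) \<le> \<eta> * norm (y - t)"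
        using eta(1) unfolding has_derivative_at_alt by blast
      have "f u - f v \<le> \<eta> * (v - u)" if "u \<le> t" "t \<le> v" "u \<in> ball t r" "v \<in> ball t r" for u v
      proof -
        \<comment> \<open>The linear part does not decrease from \<open>u\<close> to
          \<open>v\<close>, and as \<open>t\<close> lies between them the remainders
          \<open>\<eta> * (t - u)\<close> and \<open>\<eta> * (v - t)\<close> add up to
          \<open>\<eta> * (v - u)\<close>.\<close>
        have "d * (u - t) \<le> d * (v - t)" using that d by (intro mult_left_mono) auto
        then show ?thesis
          using r(2)[of u] r(2)[of v] that by (auto simp: dist_real_def algebra_simps abs_le_iff)
      qed
      then show ?thesis using r(1) by blast
    qed
    then obtain r where r: "\<And>t. t \<in> {a..b} - N \<Longrightarrow> r t > 0"
      "\<And>t u v. \<lbrakk>t \<in> {a..b} - N; u \<le> t; t \<le> v; u \<in> ball t (r t); v \<in> ball t (r t)\<rbrakk> \<Longrightarrow> f u - f v \<le> \<eta> * (v - u)"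
      by metis
    \<comment> \<open>\<open>UNIV\<close> completes the gauge off \<open>{a..b}\<close>, where no
      tag of the division lies.\<close>
    define \<gamma> where "\<gamma> t = (if t \<in> N then U else if t \<in> {a..b} then ball t (r t) else UNIV)" for t
    have "gauge \<gamma>"
      using U r(1) by (auto simp: gauge_def \<gamma>_def)
    then obtain p where p: "p tagged_division_of (cbox a b)" "\<gamma> fine p"
      by (rule fine_division_exists)
    note pD = tagged_division_ofD[OF p(1)]
    define p1 where "p1 = {xk\<in>p. fst xk \<in> N}"
    define p2 where "p2 = {xk\<in>p. fst xk \<notin> N}"
    have psplit: "p = p1 \<union> p2" "p1 \<inter> p2 = {}" "p1 \<subseteq> p" "p2 \<subseteq> p" "finite p1" "finite p2"
      using pD(1) by (auto simp: p1_def p2_def)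
    have interval: "k = {Inf k..Sup k} \<and> Inf k \<le> x \<and> x \<le> Sup k \<and> a \<le> Inf k \<and> Sup k \<le> b"
      if xk: "(x, k) \<in> p" for x k
    proof -
      obtain u v where "k = {u..v}" using pD(4)[OF xk] by auto
      then show ?thesis using pD(2,3)[OF xk] by auto
    qed
    have "p1 tagged_partial_division_of (cbox a b)"
      using p(1) psplit(3) tagged_partial_division_subset tagged_division_of_def by blast
    then have p1: "p1 tagged_division_of (\<Union>(snd ` p1))"
      by (rule tagged_partial_division_of_Union_self)
    define E where "E = snd ` p1"
    have div: "E division_of \<Union>E"
      unfolding E_def using division_of_tagged_division[OF p1] by simp
    define D1 where "D1 = (\<lambda>k. (Inf k, Sup k)) ` E"
    have E_interval: "k = {Inf k..Sup k} \<and> Inf k \<le> Sup k \<and> a \<le> Inf k \<and> Sup k \<le> b \<and> k \<subseteq> U"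
      if k: "k \<in> E" for k
    proof -
      obtain x where xk: "(x, k) \<in> p" "x \<in> N" using k by (auto simp: E_def p1_def)
      then have "k \<subseteq> \<gamma> x" using p(2) by (auto simp: fine_def)
      then have "k \<subseteq> U" using xk(2) by (simp add: \<gamma>_def)
      then show ?thesis using interval[OF xk(1)] by auto
    qed
    have inj: "inj_on (\<lambda>k. (Inf k, Sup k)) E"
      by (rule inj_onI) (metis E_interval prod.inject)
    have "(\<Sum>(u, v)\<in>D1. norm (f v - f u)) < \<eta>"
    proof (rule D)
      show "finite D1" using psplit by (simp add: D1_def E_def)
      show "\<forall>(u, v)\<in>D1. a \<le> u \<and> u \<le> v \<and> v \<le> b"
        using E_interval by (auto simp: D1_def)
      show "disjoint_family_on (\<lambda>(u, v). {u<..<v}) D1"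
        unfolding disjoint_family_on_def
      proof (intro ballI impI)
        fix P Q assume "P \<in> D1" "Q \<in> D1" "P \<noteq> Q"
        then obtain k l where kl: "k \<in> E" "l \<in> E" "k \<noteq> l" "P = (Inf k, Sup k)" "Q = (Inf l, Sup l)"
          by (auto simp: D1_def)
        have "interior k \<inter> interior l = {}" using division_ofD(5)[OF div] kl by blast
        moreover have "interior k = {Inf k<..<Sup k}" "interior l = {Inf l<..<Sup l}"
          using E_interval kl by (metis interior_atLeastAtMost_real)+
        ultimately show "(case P of (u, v) \<Rightarrow> {u<..<v}) \<inter> (case Q of (u, v) \<Rightarrow> {u<..<v}) = {}"
          using kl by simp
      qed
      \<comment> \<open>The intervals in \<open>E\<close> do not overlap and lie in
        \<open>U\<close>, so their total length is at most the measure of \<open>U\<close>.\<close>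
      have "(\<Sum>(u, v)\<in>D1. v - u) = (\<Sum>k\<in>E. Sup k - Inf k)"
        using inj by (simp add: D1_def sum.reindex)
      also have "\<dots> = (\<Sum>k\<in>E. measure lebesgue k)"
      proof (rule sum.cong[OF refl])
        fix k assume "k \<in> E"
        then have k: "k = {Inf k..Sup k}" "Inf k \<le> Sup k" using E_interval by blast+
        show "Sup k - Inf k = measure lebesgue k"
          by (subst k(1)) (simp add: k(2))
      qed
      also have "\<dots> = measure lebesgue (\<Union>E)"
        using content_division[OF div] by simp
      also have "\<dots> \<le> measure lebesgue U"
        using E_interval U(3) lmeasurable_division[OF div] by (intro measure_mono_fmeasurable) auto
      finally show "(\<Sum>(u, v)\<in>D1. v - u) < \<delta>" using U(4) by simp
    qed
    then have "(\<Sum>k\<in>E. \<bar>f (Sup k) - f (Inf k)\<bar>) < \<eta>"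
      using inj by (simp add: D1_def sum.reindex)
    moreover have "(\<Sum>k\<in>E. \<bar>f (Sup k) - f (Inf k)\<bar>) = (\<Sum>(x, k)\<in>p1. \<bar>f (Sup k) - f (Inf k)\<bar>)"
    proof -
      \<comment> \<open>Passing from tagged intervals to intervals requires the value 0 on every box
        with empty interior; the case distinction secures this for the empty set and leaves the
        values on \<open>E\<close> unchanged.\<close>
      define g where "g k = (if k = {} then 0 else \<bar>f (Sup k) - f (Inf k)\<bar>)" for k
      have "(\<Sum>(x, k)\<in>p1. g k) = (\<Sum>k\<in>E. g k)"
        unfolding E_def
      proof (rule sum.over_tagged_division_lemma[OF p1])
        show "g (cbox u v) = 0" if "box u v = {}" for u v
          using that by (cases "u = v") (auto simp: g_def)
      qed
      moreover have g: "g k = \<bar>f (Sup k) - f (Inf k)\<bar>" if "k \<in> E" for k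
        using division_ofD(3)[OF div that] by (simp add: g_def)
      moreover have "(\<Sum>(x, k)\<in>p1. g k) = (\<Sum>(x, k)\<in>p1. \<bar>f (Sup k) - f (Inf k)\<bar>)"
      proof (rule sum.cong[OF refl], clarify)
        fix x k assume "(x, k) \<in> p1"
        then have "k \<in> E" unfolding E_def by (rule image_eqI[rotated]) simp
        then show "g k = \<bar>f (Sup k) - f (Inf k)\<bar>" by (rule g)
      qed
      ultimately show ?thesis by simp
    qed
    moreover have "(\<Sum>(x, k)\<in>p1. f (Inf k) - f (Sup k)) \<le> (\<Sum>(x, k)\<in>p1. \<bar>f (Sup k) - f (Inf k)\<bar>)"
      by (rule sum_mono) auto
    ultimately have s1: "(\<Sum>(x, k)\<in>p1. f (Inf k) - f (Sup k)) \<le> \<eta>" by simp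
    have "(\<Sum>(x, k)\<in>p2. f (Inf k) - f (Sup k)) \<le> (\<Sum>(x, k)\<in>p2. \<eta> * (Sup k - Inf k))"
    proof (rule sum_mono, clarify)
      fix x k assume "(x, k) \<in> p2"
      then have xk: "(x, k) \<in> p" "x \<notin> N" by (auto simp: p2_def)
      note i = interval[OF xk(1)]
      have "k \<subseteq> \<gamma> x" using p(2) xk(1) by (auto simp: fine_def)
      then have "k \<subseteq> ball x (r x)" using xk(2) i by (simp add: \<gamma>_def)
      moreover have "Inf k \<in> k" "Sup k \<in> k" using i by (metis atLeastAtMost_iff order_refl order_trans)+
      ultimately show "f (Inf k) - f (Sup k) \<le> \<eta> * (Sup k - Inf k)"
        using i xk(2) by (intro r(2)[of x]) auto
    qed
    also have "\<dots> \<le> (\<Sum>(x, k)\<in>p. \<eta> * (Sup k - Inf k))"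
    proof (rule sum_mono2)
      fix xk assume "xk \<in> p - p2"
      then obtain x k where "xk = (x, k)" "(x, k) \<in> p" by (cases xk) auto
      then show "0 \<le> (case xk of (x, k) \<Rightarrow> \<eta> * (Sup k - Inf k))"
        using interval[of x k] eta(1) by fastforce
    qed (use psplit pD(1) in auto)
    also have "\<dots> = \<eta> * (\<Sum>(x, k)\<in>p. Sup k - Inf k)"
      by (simp add: sum_distrib_left case_prod_beta)
    also have "(\<Sum>(x, k)\<in>p. Sup k - Inf k) = b - a"
      using additive_tagged_division_1[OF ab, of p "\<lambda>x. x"] p(1) by simp
    finally have s2: "(\<Sum>(x, k)\<in>p2. f (Inf k) - f (Sup k)) \<le> \<eta> * (b - a)" .
    have "f a - f b = - (\<Sum>(x, k)\<in>p. f (Sup k) - f (Inf k))"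
      using additive_tagged_division_1[OF ab, of p f] p(1) by simp
    also have "\<dots> = (\<Sum>(x, k)\<in>p. f (Inf k) - f (Sup k))"
      by (simp add: sum_negf[symmetric] case_prod_beta)
    also have "\<dots> = (\<Sum>(x, k)\<in>p1. f (Inf k) - f (Sup k)) + (\<Sum>(x, k)\<in>p2. f (Inf k) - f (Sup k))"
      using psplit by (simp add: sum.union_disjoint)
    finally show ?thesis using s1 s2 eta(2) by simp
  qed
  then show ?thesis using field_le_epsilon[of "f a - f b" 0] by simp
qed

section \<open>Comparison and mean value estimates\<close>

lemma absolutely_continuous_deriv_ge:
  fixes f \<phi> \<phi>' :: "real \<Rightarrow> real"
  assumes ac: "absolutely_continuous_on_interval a b f" and ab: "a \<le> b"
    and N: "negligible N"
    and \<phi>: "\<And>t. t \<in> {a..b} \<Longrightarrow> (\<phi> has_real_derivative \<phi>' t) (at t)" "continuous_on {a..b} \<phi>'"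
    and der: "\<And>t. t \<in> {a..b} - N \<Longrightarrow> \<exists>d\<ge>\<phi>' t. (f has_real_derivative d) (at t)"
  shows "\<phi> b - \<phi> a \<le> f b - f a"
proof -
  \<comment> \<open>A bounded derivative makes \<open>\<phi>\<close> Lipschitz, so
    \<open>f - \<phi>\<close> is again absolutely continuous and the monotonicity criterion applies
    to it.\<close>
  have "bounded (\<phi>' ` {a..b})"
    using \<phi>(2) by (intro compact_imp_bounded compact_continuous_image) auto
  then obtain L where L: "L > 0" "\<And>t. t \<in> {a..b} \<Longrightarrow> \<bar>\<phi>' t\<bar> \<le> L"
    by (auto simp: bounded_pos)
  have lip: "\<bar>\<phi> v - \<phi> u\<bar> \<le> L * (v - u)" if "a \<le> u" "u \<le> v" "v \<le> b" for u v
  proof -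
    have "norm (\<phi> v - \<phi> u) \<le> L * norm (v - u)"
      by (rule field_differentiable_bound[of "{a..b}" \<phi> \<phi>'])
        (use \<phi>(1) L that in \<open>auto intro: has_field_derivative_at_within\<close>)
    then show ?thesis using that by simp
  qed
  have "f a - \<phi> a \<le> f b - \<phi> b"
  proof (rule absolutely_continuous_mono[where f = "\<lambda>t. f t - \<phi> t", OF _ ab N])
    show "absolutely_continuous_on_interval a b (\<lambda>t. f t - \<phi> t)"
    proof (rule absolutely_continuous_dominated[OF ac, of 1 L])
      show "norm (f v - \<phi> v - (f u - \<phi> u)) \<le> 1 * norm (f v - f u) + L * (v - u)"
        if "a \<le> u" "u \<le> v" "v \<le> b" for u v
        using lip[OF that] abs_triangle_ineq4[of "f v - f u" "\<phi> v - \<phi> u"]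
        by (simp add: algebra_simps)
    qed (use L in auto)
    show "\<exists>d\<ge>0. ((\<lambda>t. f t - \<phi> t) has_real_derivative d) (at t)" if t: "t \<in> {a..b} - N" for t
    proof -
      obtain d where d: "d \<ge> \<phi>' t" "(f has_real_derivative d) (at t)" using der[OF t] by blast
      then have "((\<lambda>t. f t - \<phi> t) has_real_derivative d - \<phi>' t) (at t)"
        using \<phi>(1) t by (intro DERIV_diff) auto
      then show ?thesis using d(1) by (intro exI[of _ "d - \<phi>' t"]) auto
    qed
  qed
  then show ?thesis by simp
qed

lemma absolutely_continuous_deriv_le:
  fixes f \<phi> \<phi>' :: "real \<Rightarrow> real"
  assumes ac: "absolutely_continuous_on_interval a b f" and ab: "a \<le> b"
    and N: "negligible N"
    and \<phi>: "\<And>t. t \<in> {a..b} \<Longrightarrow> (\<phi> has_real_derivative \<phi>' t) (at t)" "continuous_on {a..b} \<phi>'"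
    and der: "\<And>t. t \<in> {a..b} - N \<Longrightarrow> \<exists>d\<le>\<phi>' t. (f has_real_derivative d) (at t)"
  shows "f b - f a \<le> \<phi> b - \<phi> a"
proof -
  have "- \<phi> b - (- \<phi> a) \<le> - f b - (- f a)"
  proof (rule absolutely_continuous_deriv_ge[where f = "\<lambda>t. - f t" and \<phi> = "\<lambda>t. - \<phi> t"
        and \<phi>' = "\<lambda>t. - \<phi>' t", OF _ ab N])
    show "absolutely_continuous_on_interval a b (\<lambda>t. - f t)"
      by (rule absolutely_continuous_dominated[OF ac, of 1 0]) auto
    show "((\<lambda>t. - \<phi> t) has_real_derivative - \<phi>' t) (at t)" if "t \<in> {a..b}" for t
      using \<phi>(1)[OF that] by (rule DERIV_minus)
    show "continuous_on {a..b} (\<lambda>t. - \<phi>' t)" using \<phi>(2) by (rule continuous_on_minus)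
    fix t assume "t \<in> {a..b} - N"
    from der[OF this] obtain d where "d \<le> \<phi>' t" "(f has_real_derivative d) (at t)" by blast
    then show "\<exists>d\<ge>- \<phi>' t. ((\<lambda>t. - f t) has_real_derivative d) (at t)"
      by (intro exI[of _ "- d"]) (auto intro: DERIV_minus)
  qed
  then show ?thesis by simp
qed

text \<open>Comparison with the lines of slope \<open>m - B\<close> and \<open>m + B\<close>. The
  choice \<open>m = 0\<close> gives growth bounds; taking \<open>m\<close> to be a candidate
  derivative controls difference quotients.\<close>

lemma absolutely_continuous_deriv_bound:
  fixes f :: "real \<Rightarrow> real"
  assumes ac: "absolutely_continuous_on_interval a b f" and ab: "a \<le> b"
    and N: "negligible N"
    and der: "\<And>t. t \<in> {a..b} - N \<Longrightarrow> \<exists>d. (f has_real_derivative d) (at t) \<and> \<bar>d - m\<bar> \<le> B"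
  shows "\<bar>f b - f a - m * (b - a)\<bar> \<le> B * (b - a)"
proof -
  have lower: "\<exists>d\<ge>m - B. (f has_real_derivative d) (at t)"
    and upper: "\<exists>d\<le>m + B. (f has_real_derivative d) (at t)" if "t \<in> {a..b} - N" for t
    using der[OF that] by (auto simp: abs_le_iff algebra_simps)
  have "(m - B) * b - (m - B) * a \<le> f b - f a"
    by (rule absolutely_continuous_deriv_ge[OF ac ab N, of "\<lambda>t. (m - B) * t" "\<lambda>t. m - B"])
      (use lower in \<open>auto intro!: derivative_eq_intros\<close>)
  moreover have "f b - f a \<le> (m + B) * b - (m + B) * a"
    by (rule absolutely_continuous_deriv_le[OF ac ab N, of "\<lambda>t. (m + B) * t" "\<lambda>t. m + B"])
      (use upper in \<open>auto intro!: derivative_eq_intros\<close>)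
  ultimately show ?thesis by (simp add: abs_le_iff algebra_simps)
qed

text \<open>By continuity of \<open>g\<close> at \<open>t0\<close>, almost all derivatives near
  \<open>t0\<close> are within \<open>\<epsilon>\<close> of \<open>g t0\<close>; the mean value
  estimate passes this on to the difference quotients at \<open>t0\<close>, even if
  \<open>t0\<close> is exceptional.\<close>

lemma absolutely_continuous_has_real_derivative:
  fixes f g :: "real \<Rightarrow> real"
  assumes ac: "\<And>a b. absolutely_continuous_on_interval a b f"
    and N: "negligible N" and t0: "l < t0" "t0 < u" and g: "isCont g t0"
    and der: "\<And>t. t \<in> {l<..<u} - N \<Longrightarrow> (f has_real_derivative g t) (at t)"
  shows "(f has_real_derivative g t0) (at t0)"
  unfolding has_field_derivative_def has_derivative_at_alt
proof (intro conjI allI impI)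
  show "bounded_linear ((*) (g t0))" by (rule bounded_linear_mult_right)
next
  fix \<epsilon> :: real assume "\<epsilon> > 0"
  then obtain \<delta> where d: "\<delta> > 0" "\<And>t. \<bar>t - t0\<bar> < \<delta> \<Longrightarrow> \<bar>g t - g t0\<bar> < \<epsilon>"
    using g[unfolded continuous_at_eps_delta, rule_format, of \<epsilon>] by (auto simp: dist_real_def)
  define \<eta> where "\<eta> = min \<delta> (min (t0 - l) (u - t0))"
  have eta: "\<eta> > 0" "\<eta> \<le> \<delta>" "\<eta> \<le> t0 - l" "\<eta> \<le> u - t0" using d t0 by (auto simp: \<eta>_def)
  have near: "\<exists>d. (f has_real_derivative d) (at t) \<and> \<bar>d - g t0\<bar> \<le> \<epsilon>"
    if "t \<notin> N" "\<bar>t - t0\<bar> < \<eta>" for t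
    using der[of t] d(2)[of t] that eta by (intro exI[of _ "g t"]) (auto simp: abs_less_iff)
  have "norm (f y - f t0 - g t0 * (y - t0)) \<le> \<epsilon> * norm (y - t0)" if y: "norm (y - t0) < \<eta>" for y
  proof (cases "t0 \<le> y")
    case True
    have "\<bar>f y - f t0 - g t0 * (y - t0)\<bar> \<le> \<epsilon> * (y - t0)"
      by (rule absolutely_continuous_deriv_bound[OF ac True N]) (use y near in auto)
    then show ?thesis using True by simp
  next
    case False
    have "\<bar>f t0 - f y - g t0 * (t0 - y)\<bar> \<le> \<epsilon> * (t0 - y)"
      by (rule absolutely_continuous_deriv_bound[OF ac _ N]) (use y near False in auto)
    then show ?thesis using False by (simp add: algebra_simps abs_minus_commute)
  qed
  then show "\<exists>d>0. \<forall>y. norm (y - t0) < d \<longrightarrow> norm (f y - f t0 - g t0 * (y - t0)) \<le> \<epsilon> * norm (y - t0)"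
    using eta(1) by blast
qed

text \<open>Bridges the gap between Filippov solutions, which obey a mode almost everywhere, and
  non-switching times, which demand the mode equation at every nearby instant. The scalar case is
  applied to each coordinate.\<close>

lemma absolutely_continuous_has_vector_derivative:
  fixes x g :: "real \<Rightarrow> 'a::euclidean_space"
  assumes ac: "\<And>a b. absolutely_continuous_on_interval a b x"
    and N: "negligible N" and t0: "l < t0" "t0 < u" and g: "isCont g t0"
    and der: "\<And>t. t \<in> {l<..<u} - N \<Longrightarrow> (x has_vector_derivative g t) (at t)"
  shows "(x has_vector_derivative g t0) (at t0)"
proof -
  have "((\<lambda>t. x t \<bullet> i) has_derivative (\<lambda>h. (h *\<^sub>R g t0) \<bullet> i)) (at t0)" if "i \<in> Basis" for i
  proof -
    have "((\<lambda>t. x t \<bullet> i) has_real_derivative g t0 \<bullet> i) (at t0)"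
    proof (rule absolutely_continuous_has_real_derivative[OF _ N t0, of "\<lambda>t. x t \<bullet> i" "\<lambda>t. g t \<bullet> i"])
      show "absolutely_continuous_on_interval a b (\<lambda>t. x t \<bullet> i)" for a b
        by (rule absolutely_continuous_dominated[OF ac, of 1 0])
          (use Basis_le_norm[OF that] in \<open>auto simp: inner_diff_left[symmetric]\<close>)
      show "isCont (\<lambda>t. g t \<bullet> i) t0" using g by (intro continuous_intros)
      show "((\<lambda>t. x t \<bullet> i) has_real_derivative g t \<bullet> i) (at t)" if "t \<in> {l<..<u} - N" for t
        using bounded_linear.has_vector_derivative[OF bounded_linear_inner_left der[OF that]]
        by (simp add: has_real_derivative_iff_has_vector_derivative)
    qed
    then show ?thesis by (simp add: has_field_derivative_def mult_commute_abs)
  qed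
  then show ?thesis
    unfolding has_vector_derivative_def
    by (subst has_derivative_componentwise_within) auto
qed

section \<open>Chains of functions with positive coupling\<close>

text \<open>Up to lower order terms, \<open>z (Suc j)\<close> is the derivative of
  \<open>z j\<close>. The factor \<open>q\<close> may vary with \<open>t\<close> and
  \<open>j\<close> within fixed positive bounds, because the velocity is an arbitrary selection from
  the convex hull. The chain stops at \<open>z n\<close>, which a separate estimate later ties to
  its predecessors.\<close>

locale positive_chain =
  fixes z :: "nat \<Rightarrow> real \<Rightarrow> real" and n :: nat and N :: "real set" and p P C :: real
  assumes ac: "j \<le> n \<Longrightarrow> absolutely_continuous_on_interval a b (z j)"
    and N: "negligible N"
    and pos: "0 < p" "p \<le> P" "0 \<le> C"
    and deriv: "\<lbrakk>t \<notin> N; j < n\<rbrakk> \<Longrightarrow> \<exists>d q. (z j has_real_derivative d) (at t) \<and> p \<le> q \<and> q \<le> P \<and>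
      \<bar>d - q * z (Suc j) t\<bar> \<le> C * (\<Sum>i\<le>j. \<bar>z i t\<bar>)"
begin

section \<open>Behaviour to the right of a point\<close>

lemma continuous: "j \<le> n \<Longrightarrow> continuous_on {a..b} (z j)"
  using ac by (rule absolutely_continuous_imp_continuous_on)

lemma deriv_bound:
  assumes "t \<notin> N" "j < n"
  shows "\<exists>d. (z j has_real_derivative d) (at t) \<and> \<bar>d\<bar> \<le> P * \<bar>z (Suc j) t\<bar> + C * (\<Sum>i\<le>j. \<bar>z i t\<bar>)"
proof -
  obtain d q where d: "(z j has_real_derivative d) (at t)" and q: "p \<le> q" "q \<le> P"
    and le: "\<bar>d - q * z (Suc j) t\<bar> \<le> C * (\<Sum>i\<le>j. \<bar>z i t\<bar>)"
    using deriv[OF assms] by blast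
  have "\<bar>q * z (Suc j) t\<bar> \<le> P * \<bar>z (Suc j) t\<bar>"
    using q pos(1) by (auto simp: abs_mult intro!: mult_right_mono)
  then show ?thesis using d le by (intro exI[of _ d]) auto
qed

text \<open>Each induction step integrates once and gains a factor \<open>t - s\<close>. The range
  of \<open>j\<close> shrinks by one each time, since the derivative of \<open>z j\<close> involves
  \<open>z (Suc j)\<close>.\<close>

lemma power_bound:
  assumes k: "k \<le> n" and zero: "\<And>j. j < k \<Longrightarrow> z j s = 0"
  shows "\<exists>K\<ge>0. \<forall>j. j + m \<le> k \<longrightarrow> (\<forall>t\<in>{s..s + 1}. \<bar>z j t\<bar> \<le> K * (t - s) ^ m)"
proof (induction m)
  case 0
  have "\<exists>B. \<forall>t\<in>{s..s + 1}. \<bar>z j t\<bar> \<le> B" if "j \<le> k" for j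
  proof -
    have "bounded (z j ` {s..s + 1})"
      using that k by (intro compact_imp_bounded compact_continuous_image continuous) auto
    then show ?thesis by (auto simp: bounded_iff)
  qed
  then obtain B where B: "\<And>j t. \<lbrakk>j \<le> k; t \<in> {s..s + 1}\<rbrakk> \<Longrightarrow> \<bar>z j t\<bar> \<le> B j" by metis
  have "\<bar>z j t\<bar> \<le> (\<Sum>i\<le>k. \<bar>B i\<bar>)" if "j \<le> k" "t \<in> {s..s + 1}" for j t
    using B[OF that] member_le_sum[of j "{..k}" "\<lambda>i. \<bar>B i\<bar>"] that(1) by auto
  then show ?case by (intro exI[of _ "\<Sum>i\<le>k. \<bar>B i\<bar>"]) (auto intro: sum_nonneg)
next
  case (Suc m)
  then obtain K where K: "K \<ge> 0"
    and le: "\<And>j t. \<lbrakk>j + m \<le> k; t \<in> {s..s + 1}\<rbrakk> \<Longrightarrow> \<bar>z j t\<bar> \<le> K * (t - s) ^ m" by blast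
  \<comment> \<open>\<open>P * K\<close> comes from the coupling term, the rest from an error sum
    with at most \<open>Suc k\<close> terms.\<close>
  define L where "L = P * K + C * (real (Suc k) * K)"
  have L: "L \<ge> 0" using K pos by (simp add: L_def)
  have "\<bar>z j t\<bar> \<le> L * (t - s) ^ Suc m" if j: "j + Suc m \<le> k" and t: "t \<in> {s..s + 1}" for j t
  proof -
    have "\<bar>z j t - z j s - 0 * (t - s)\<bar> \<le> (L * (t - s) ^ m) * (t - s)"
    proof (rule absolutely_continuous_deriv_bound[OF ac _ N])
      fix r assume r: "r \<in> {s..t} - N"
      then have r': "r \<in> {s..s + 1}" using t by auto
      obtain d where d: "(z j has_real_derivative d) (at r)"
        "\<bar>d\<bar> \<le> P * \<bar>z (Suc j) r\<bar> + C * (\<Sum>i\<le>j. \<bar>z i r\<bar>)"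
        using deriv_bound[of r j] r j k by auto
      have "(\<Sum>i\<le>j. \<bar>z i r\<bar>) \<le> real (card {..j}) * (K * (r - s) ^ m)"
        by (rule sum_bounded_above) (use le r' j in auto)
      also have "\<dots> \<le> real (Suc k) * (K * (r - s) ^ m)"
        using j r' K by (intro mult_right_mono) auto
      finally have "\<bar>d\<bar> \<le> P * (K * (r - s) ^ m) + C * (real (Suc k) * (K * (r - s) ^ m))"
        using d(2) le[of "Suc j" r] r' j pos
        by (intro order_trans[OF d(2)] add_mono mult_left_mono) auto
      also have "\<dots> = L * (r - s) ^ m" by (simp add: L_def algebra_simps)
      also have "\<dots> \<le> L * (t - s) ^ m"
        using r L by (intro mult_left_mono power_mono) auto
      finally show "\<exists>d. (z j has_real_derivative d) (at r) \<and> \<bar>d - 0\<bar> \<le> L * (t - s) ^ m"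
        using d(1) by auto
    qed (use t j k in auto)
    then show ?thesis using zero[of j] j by (simp add: mult_ac)
  qed
  then show ?case using L by blast
qed

text \<open>Descending from \<open>z k\<close>, which stays above half its initial value, the lower
  bound \<open>c * (t - s) ^ m\<close> for \<open>z (k - m)\<close> is integrated once per step. The
  error is of order \<open>(t - s) ^ Suc m\<close> by \<open>power_bound\<close> and is absorbed on
  a shorter interval.\<close>

lemma positive_right:
  assumes k: "k \<le> n" and zero: "\<And>j. j < k \<Longrightarrow> z j s = 0" and start: "z k s > 0"
  shows "\<exists>\<epsilon>>0. \<forall>t\<in>{s<..<s + \<epsilon>}. z 0 t > 0"
proof -
  have "\<exists>c>0. \<exists>\<epsilon>>0. \<epsilon> \<le> 1 \<and> (\<forall>t\<in>{s..s + \<epsilon>}. c * (t - s) ^ m \<le> z (k - m) t)" if "m \<le> k" for m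
    using that
  proof (induction m)
    case 0
    have "continuous_on {s..s + 1} (z k)" using continuous k by simp
    then obtain \<delta> where d: "\<delta> > 0"
      "\<And>t. \<lbrakk>t \<in> {s..s + 1}; dist t s < \<delta>\<rbrakk> \<Longrightarrow> dist (z k t) (z k s) < z k s / 2"
      unfolding continuous_on_iff using start by (metis atLeastAtMost_iff half_gt_zero less_add_one less_imp_le order_refl)
    have "z k s / 2 \<le> z k t" if "t \<in> {s..s + min 1 (\<delta> / 2)}" for t
    proof -
      have "t \<in> {s..s + 1}" "dist t s < \<delta>" using that d(1) by (auto simp: dist_real_def)
      then have "\<bar>z k t - z k s\<bar> < z k s / 2" using d(2) by (simp add: dist_real_def)
      then show ?thesis by linarith
    qed
    then show ?case using d(1) start
      by (intro exI[of _ "z k s / 2"] conjI exI[of _ "min 1 (\<delta> / 2)"]) auto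
  next
    case (Suc m)
    then obtain c \<epsilon> where c: "c > 0" and \<epsilon>: "\<epsilon> > 0" "\<epsilon> \<le> 1"
      and low: "\<And>t. t \<in> {s..s + \<epsilon>} \<Longrightarrow> c * (t - s) ^ m \<le> z (k - m) t" by auto
    obtain K where K: "K \<ge> 0"
      and up: "\<And>j t. \<lbrakk>j + Suc m \<le> k; t \<in> {s..s + 1}\<rbrakk> \<Longrightarrow> \<bar>z j t\<bar> \<le> K * (t - s) ^ Suc m"
      using power_bound[OF k zero] by metis
    define j where "j = k - Suc m"
    have j: "Suc j = k - m" "j + Suc m = k" "j < n" using Suc.prems k by (auto simp: j_def)
    \<comment> \<open>The error is at most \<open>R * (r - s) ^ Suc m\<close>, while the coupling
      contributes at least \<open>2 * c' * (r - s) ^ m\<close>. The choice of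
      \<open>\<epsilon>'\<close> lets the error consume only half of that; \<open>R + 1\<close>
      avoids division by zero.\<close>
    define R where "R = C * (real (Suc j) * K)"
    have R: "R \<ge> 0" using K pos by (simp add: R_def)
    define c' where "c' = p * c / 2"
    have c': "c' > 0" using c pos by (simp add: c'_def)
    define \<epsilon>' where "\<epsilon>' = min \<epsilon> (c' / (R + 1))"
    have \<epsilon>': "\<epsilon>' > 0" "\<epsilon>' \<le> 1" "\<epsilon>' \<le> \<epsilon>" "R * \<epsilon>' \<le> c'"
    proof -
      show "\<epsilon>' > 0" "\<epsilon>' \<le> 1" "\<epsilon>' \<le> \<epsilon>" using \<epsilon> c' R by (auto simp: \<epsilon>'_def)
      have "R * \<epsilon>' \<le> R * (c' / (R + 1))" using R by (intro mult_left_mono) (auto simp: \<epsilon>'_def)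
      also have "\<dots> \<le> c'" using R c' by (simp add: field_simps)
      finally show "R * \<epsilon>' \<le> c'" .
    qed
    \<comment> \<open>Antiderivative of \<open>c' * (r - s) ^ m\<close> vanishing at
      \<open>s\<close>, as \<open>z j\<close> does too because \<open>j < k\<close>.\<close>
    define \<phi> where "\<phi> r = c' / real (Suc m) * (r - s) ^ Suc m" for r
    have "\<phi> t - \<phi> s \<le> z j t - z j s" if t: "t \<in> {s..s + \<epsilon>'}" for t
    proof (rule absolutely_continuous_deriv_ge[OF ac _ N, where \<phi> = \<phi> and \<phi>' = "\<lambda>r. c' * (r - s) ^ m"])
      show "(\<phi> has_real_derivative c' * (r - s) ^ m) (at r)" for r
      proof -
        have "(\<phi> has_real_derivative c' / real (Suc m) * (real (Suc m) * (r - s) ^ m)) (at r)"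
          unfolding \<phi>_def
          by (rule DERIV_cmult, rule DERIV_cong[OF DERIV_power[where D = 1]])
            (auto intro!: derivative_eq_intros)
        then show ?thesis by simp
      qed
      show "continuous_on {s..t} (\<lambda>r. c' * (r - s) ^ m)" by (intro continuous_intros)
      fix r assume r: "r \<in> {s..t} - N"
      then have r': "r \<in> {s..s + 1}" "r \<in> {s..s + \<epsilon>}" "0 \<le> r - s" "r - s \<le> \<epsilon>'" using t \<epsilon>' by auto
      obtain d q where d: "(z j has_real_derivative d) (at r)" "p \<le> q"
        "\<bar>d - q * z (Suc j) r\<bar> \<le> C * (\<Sum>i\<le>j. \<bar>z i r\<bar>)"
        using deriv[of r j] r j by auto
      have "(\<Sum>i\<le>j. \<bar>z i r\<bar>) \<le> real (card {..j}) * (K * (r - s) ^ Suc m)"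
        by (rule sum_bounded_above) (use up r' j in auto)
      then have "C * (\<Sum>i\<le>j. \<bar>z i r\<bar>) \<le> C * (real (Suc j) * (K * (r - s) ^ Suc m))"
        using pos by (intro mult_left_mono) auto
      also have "\<dots> = (R * (r - s)) * (r - s) ^ m" by (simp add: R_def algebra_simps)
      also have "R * (r - s) \<le> c'"
        using r' R by (intro order_trans[OF _ \<epsilon>'(4)] mult_left_mono) auto
      finally have "C * (\<Sum>i\<le>j. \<bar>z i r\<bar>) \<le> c' * (r - s) ^ m"
        using r'(3) by (simp add: mult_right_mono)
      moreover have "p * (c * (r - s) ^ m) \<le> q * z (Suc j) r"
        using low[OF r'(2)] d(2) pos c r'(3) j by (intro mult_mono) auto
      ultimately have "c' * (r - s) ^ m \<le> d"
        using d(3) by (simp add: c'_def abs_le_iff)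
      then show "\<exists>d\<ge>c' * (r - s) ^ m. (z j has_real_derivative d) (at r)" using d(1) by blast
    qed (use t j in auto)
    then have "c' / real (Suc m) * (t - s) ^ Suc m \<le> z (k - Suc m) t" if "t \<in> {s..s + \<epsilon>'}" for t
      using that zero[of j] j by (auto simp: \<phi>_def j_def)
    then show ?case using c' \<epsilon>'
      by (intro exI[of _ "c' / real (Suc m)"] conjI exI[of _ \<epsilon>']) auto
  qed
  from this[of k] obtain c \<epsilon> where c: "c > 0" "\<epsilon> > 0" "\<And>t. t \<in> {s..s + \<epsilon>} \<Longrightarrow> c * (t - s) ^ k \<le> z 0 t"
    by auto
  have "z 0 t > 0" if "t \<in> {s<..<s + \<epsilon>}" for t
  proof -
    have "0 < c * (t - s) ^ k" using that c(1) by simp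
    also have "\<dots> \<le> z 0 t" using that c(3) by simp
    finally show ?thesis .
  qed
  then show ?thesis using c(2) by blast
qed

text \<open>The bound on \<open>z n\<close> closes the chain, so all derivatives are controlled by
  the sum \<open>\<sigma>\<close> itself. On a short interval its maximum \<open>\<mu>\<close> then
  satisfies \<open>\<mu> \<le> \<mu> / 2\<close>, which is Gronwall's argument in contraction
  form.\<close>

lemma zero_right:
  assumes zero: "\<And>j. j < n \<Longrightarrow> z j s = 0" and n: "n > 0"
    and B: "\<And>t. \<bar>z n t\<bar> \<le> B * (\<Sum>j<n. \<bar>z j t\<bar>)" "B \<ge> 0"
  shows "\<exists>\<epsilon>>0. \<forall>t\<in>{s<..<s + \<epsilon>}. \<forall>j\<le>n. z j t = 0"
proof -
  define L where "L = P * (1 + B) + C"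
  have L: "L \<ge> 0" using pos B by (simp add: L_def)
  \<comment> \<open>Chosen so that \<open>real n * L * \<delta> \<le> 1 / 2\<close>.\<close>
  define \<delta> where "\<delta> = 1 / (2 * real n * (L + 1))"
  have \<delta>: "\<delta> > 0" using n L by (simp add: \<delta>_def)
  define \<sigma> where "\<sigma> t = (\<Sum>j<n. \<bar>z j t\<bar>)" for t
  have "continuous_on {s..s + \<delta>} \<sigma>"
    unfolding \<sigma>_def by (intro continuous_intros continuous) auto
  then obtain t1 where t1: "t1 \<in> {s..s + \<delta>}" "\<And>t. t \<in> {s..s + \<delta>} \<Longrightarrow> \<sigma> t \<le> \<sigma> t1"
    using continuous_attains_sup[of "{s..s + \<delta>}" \<sigma>] \<delta> by auto
  define \<mu> where "\<mu> = \<sigma> t1"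
  have \<mu>: "\<mu> \<ge> 0" by (auto simp: \<mu>_def \<sigma>_def intro: sum_nonneg)
  have z_le: "\<bar>z j t\<bar> \<le> \<sigma> t" if "j < n" for j t
    unfolding \<sigma>_def using that by (intro member_le_sum) auto
  have each: "\<bar>z j t1\<bar> \<le> L * \<mu> * \<delta>" if j: "j < n" for j
  proof -
    have "\<bar>z j t1 - z j s - 0 * (t1 - s)\<bar> \<le> (L * \<mu>) * (t1 - s)"
    proof (rule absolutely_continuous_deriv_bound[OF ac _ N])
      fix r assume r: "r \<in> {s..t1} - N"
      then have \<sigma>r: "\<sigma> r \<le> \<mu>" using t1 by (auto simp: \<mu>_def)
      obtain d where d: "(z j has_real_derivative d) (at r)"
        "\<bar>d\<bar> \<le> P * \<bar>z (Suc j) r\<bar> + C * (\<Sum>i\<le>j. \<bar>z i r\<bar>)"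
        using deriv_bound[of r j] r j by auto
      have "(\<Sum>i\<le>j. \<bar>z i r\<bar>) \<le> \<sigma> r"
        unfolding \<sigma>_def using j by (intro sum_mono2) auto
      then have 1: "(\<Sum>i\<le>j. \<bar>z i r\<bar>) \<le> \<mu>" using \<sigma>r by simp
      \<comment> \<open>The factor \<open>1 + B\<close> serves both cases: a successor that is a
        summand of \<open>\<sigma>\<close>, and the last function, controlled through
        \<open>B\<close>.\<close>
      have "\<bar>z (Suc j) r\<bar> \<le> (1 + B) * \<sigma> r"
      proof (cases "Suc j < n")
        case True
        have "0 \<le> B * \<sigma> r" using B(2) by (auto simp: \<sigma>_def intro!: mult_nonneg_nonneg sum_nonneg)
        then show ?thesis using z_le[OF True, of r] by (simp add: algebra_simps)
      next
        case False
        then have "Suc j = n" using j by simp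
        moreover have "0 \<le> \<sigma> r" by (auto simp: \<sigma>_def intro: sum_nonneg)
        ultimately show ?thesis using B(1)[of r] unfolding \<sigma>_def[symmetric]
            by (simp add: distrib_right)
      qed
      also have "\<dots> \<le> (1 + B) * \<mu>" using \<sigma>r B by (intro mult_left_mono) auto
      finally have "\<bar>d\<bar> \<le> P * ((1 + B) * \<mu>) + C * \<mu>"
        using 1 pos by (intro order_trans[OF d(2)] add_mono mult_left_mono) auto
      then have "\<bar>d - 0\<bar> \<le> L * \<mu>" by (simp add: L_def algebra_simps)
      then show "\<exists>d. (z j has_real_derivative d) (at r) \<and> \<bar>d - 0\<bar> \<le> L * \<mu>"
        using d(1) by blast
    qed (use t1 j in auto)
    also have "\<dots> \<le> L * \<mu> * \<delta>" using t1 L \<mu> by (intro mult_left_mono) auto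
    finally show ?thesis using zero[OF j] by simp
  qed
  have "\<mu> \<le> real (card {..<n}) * (L * \<mu> * \<delta>)"
    unfolding \<mu>_def \<sigma>_def by (rule sum_bounded_above) (use each in \<open>auto simp: \<mu>_def \<sigma>_def\<close>)
  also have "\<dots> = \<mu> * (L / (2 * (L + 1)))" using n by (simp add: \<delta>_def)
  also have "\<dots> \<le> \<mu> * (1 / 2)" using L \<mu> by (intro mult_left_mono) (auto simp: field_simps)
  finally have "\<mu> = 0" using \<mu> by simp
  have "z j t = 0" if t: "t \<in> {s<..<s + \<delta>}" and j: "j \<le> n" for j t
  proof -
    have \<sigma>t: "\<sigma> t \<le> 0" using t1(2)[of t] t \<open>\<mu> = 0\<close> by (auto simp: \<mu>_def)
    show ?thesis
    proof (cases "j < n")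
      case True
      then show ?thesis using z_le[OF True, of t] \<sigma>t by simp
    next
      case False
      then have "j = n" using j by simp
      moreover have "B * \<sigma> t \<le> 0" using B(2) \<sigma>t by (rule mult_nonneg_nonpos)
      ultimately show ?thesis using B(1)[of t] by (simp add: \<sigma>_def)
    qed
  qed
  then show ?thesis using \<delta> by blast
qed

section \<open>Change of sign, reversal of time and the sign trichotomy\<close>

lemma uminus_chain: "positive_chain (\<lambda>j t. - z j t) n N p P C"
proof
  show "absolutely_continuous_on_interval a b (\<lambda>t. - z j t)" if "j \<le> n" for a b j
    by (rule absolutely_continuous_dominated[OF ac[OF that], of 1 0]) auto
  fix t j assume "t \<notin> N" "j < n"
  from deriv[OF this] obtain d q where d: "(z j has_real_derivative d) (at t)" "p \<le> q" "q \<le> P"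
    "\<bar>d - q * z (Suc j) t\<bar> \<le> C * (\<Sum>i\<le>j. \<bar>z i t\<bar>)" by blast
  have "((\<lambda>t. - z j t) has_real_derivative - d) (at t)" using d(1) by (rule DERIV_minus)
  then show "\<exists>d q. ((\<lambda>t. - z j t) has_real_derivative d) (at t) \<and> p \<le> q \<and> q \<le> P \<and>
      \<bar>d - q * - z (Suc j) t\<bar> \<le> C * (\<Sum>i\<le>j. \<bar>- z i t\<bar>)"
    using d(2-) by (intro exI[of _ "- d"] exI[of _ q]) (auto simp: abs_le_iff)
qed (use N pos in auto)

text \<open>
  Each derivative in the chain reverses its sign under time reversal; the signs \<open>(-1)\<^sup>j\<close>
  compensate for this.
\<close>

lemma reflected_chain: "positive_chain (\<lambda>j t. (- 1) ^ j * z j (- t)) n (uminus ` N) p P C"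
proof
  show "absolutely_continuous_on_interval a b (\<lambda>t. (- 1) ^ j * z j (- t))" if "j \<le> n" for a b j
    by (rule absolutely_continuous_dominated[OF absolutely_continuous_reflect[OF ac[OF that]], of 1 0])
      (auto simp: right_diff_distrib[symmetric] abs_mult)
  show "negligible (uminus ` N)"
    by (rule negligible_differentiable_image_negligible[OF _ N])
      (auto simp: differentiable_on_def intro!: derivative_intros)
  fix t j assume "t \<notin> uminus ` N" "j < n"
  then have "- t \<notin> N" by (metis image_eqI minus_minus)
  from deriv[OF this \<open>j < n\<close>] obtain d q where
    d: "(z j has_real_derivative d) (at (- t))" and q: "p \<le> q" "q \<le> P"
    "\<bar>d - q * z (Suc j) (- t)\<bar> \<le> C * (\<Sum>i\<le>j. \<bar>z i (- t)\<bar>)" by blast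
  have "((\<lambda>t. z j (- t)) has_real_derivative d * (- 1)) (at t)"
    by (rule DERIV_chain2[where f = "z j" and g = uminus, OF d]) (auto intro!: derivative_eq_intros)
  then have "((\<lambda>t. (- 1) ^ j * z j (- t)) has_real_derivative (- 1) ^ j * (d * (- 1))) (at t)"
    by (rule DERIV_cmult)
  moreover have "(- 1) ^ j * (d * (- 1)) - q * ((- 1) ^ Suc j * z (Suc j) (- t)) =
      (- 1) ^ Suc j * (d - q * z (Suc j) (- t))"
    by (simp add: algebra_simps)
  ultimately show "\<exists>d q. ((\<lambda>t. (- 1) ^ j * z j (- t)) has_real_derivative d) (at t) \<and> p \<le> q \<and> q \<le> P \<and>
      \<bar>d - q * ((- 1) ^ Suc j * z (Suc j) (- t))\<bar> \<le> C * (\<Sum>i\<le>j. \<bar>(- 1) ^ i * z i (- t)\<bar>)"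
    using q by (intro exI[of _ "(- 1) ^ j * (d * (- 1))"] exI[of _ q]) (auto simp: abs_mult)
qed (use pos in auto)

text \<open>The first function not vanishing at \<open>s\<close> decides the sign; if there is none,
  \<open>zero_right\<close> applies. Assumption \<open>B\<close> is conditional on a common zero
  because for affine observations the bound is obtained by taking such a zero as origin.\<close>

lemma trichotomy_right:
  assumes n: "n > 0"
    and B: "(\<And>j. j \<le> n \<Longrightarrow> z j s = 0) \<Longrightarrow> \<exists>B\<ge>0. \<forall>t. \<bar>z n t\<bar> \<le> B * (\<Sum>j<n. \<bar>z j t\<bar>)"
  shows "\<exists>\<epsilon>>0. (\<forall>t\<in>{s<..<s + \<epsilon>}. z 0 t > 0) \<or> (\<forall>t\<in>{s<..<s + \<epsilon>}. z 0 t < 0) \<or>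
    (\<forall>t\<in>{s<..<s + \<epsilon>}. \<forall>j\<le>n. z j t = 0)"
proof (cases "\<forall>j\<le>n. z j s = 0")
  case True
  then obtain B where "B \<ge> 0" "\<And>t. \<bar>z n t\<bar> \<le> B * (\<Sum>j<n. \<bar>z j t\<bar>)" using B by blast
  then show ?thesis using zero_right[of s B] True n by auto
next
  case False
  define k where "k = (LEAST j. z j s \<noteq> 0)"
  obtain i where i: "i \<le> n" "z i s \<noteq> 0" using False by blast
  have k: "k \<le> n" "z k s \<noteq> 0" and zero: "\<And>j. j < k \<Longrightarrow> z j s = 0"
    using i LeastI[of "\<lambda>j. z j s \<noteq> 0" i] Least_le[of "\<lambda>j. z j s \<noteq> 0" i] not_less_Least
    unfolding k_def by (auto simp del: LeastI)
  show ?thesis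
  proof (cases "z k s > 0")
    case True
    then show ?thesis using positive_right[OF k(1) zero] by blast
  next
    case False
    interpret neg: positive_chain "\<lambda>j t. - z j t" n N p P C by (rule uminus_chain)
    show ?thesis using neg.positive_right[OF k(1), of s] zero False k(2) by auto
  qed
qed

text \<open>This is the right-hand version at \<open>- s\<close> for the reflected chain. The sign
  factor at index 0 is 1, so the sign of \<open>z 0\<close> carries over.\<close>

lemma trichotomy_left:
  assumes n: "n > 0"
    and B: "(\<And>j. j \<le> n \<Longrightarrow> z j s = 0) \<Longrightarrow> \<exists>B\<ge>0. \<forall>t. \<bar>z n t\<bar> \<le> B * (\<Sum>j<n. \<bar>z j t\<bar>)"
  shows "\<exists>\<epsilon>>0. (\<forall>t\<in>{s - \<epsilon><..<s}. z 0 t > 0) \<or> (\<forall>t\<in>{s - \<epsilon><..<s}. z 0 t < 0) \<or>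
    (\<forall>t\<in>{s - \<epsilon><..<s}. \<forall>j\<le>n. z j t = 0)"
proof -
  interpret ref: positive_chain "\<lambda>j t. (- 1) ^ j * z j (- t)" n "uminus ` N" p P C
    by (rule reflected_chain)
  have B': "\<exists>B\<ge>0. \<forall>t. \<bar>(- 1) ^ n * z n (- t)\<bar> \<le> B * (\<Sum>j<n. \<bar>(- 1) ^ j * z j (- t)\<bar>)"
    if "\<And>j. j \<le> n \<Longrightarrow> (- 1) ^ j * z j (- (- s)) = 0"
  proof -
    have "z j s = 0" if "j \<le> n" for j using \<open>\<And>j. j \<le> n \<Longrightarrow> (- 1) ^ j * z j (- (- s)) = 0\<close>[OF that] by simp
    then show ?thesis using B by (auto simp: abs_mult)
  qed
  obtain \<epsilon> where \<epsilon>: "\<epsilon> > 0" and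
    cases: "(\<forall>t\<in>{- s<..<- s + \<epsilon>}. z 0 (- t) > 0) \<or> (\<forall>t\<in>{- s<..<- s + \<epsilon>}. z 0 (- t) < 0) \<or>
      (\<forall>t\<in>{- s<..<- s + \<epsilon>}. \<forall>j\<le>n. z j (- t) = 0)"
    using ref.trichotomy_right[OF n, of "- s"] B' by (auto simp: add.commute[of "- s"])
  have img: "t \<in> {s - \<epsilon><..<s} \<Longrightarrow> - t \<in> {- s<..<- s + \<epsilon>}" for t by auto
  show ?thesis using \<epsilon> cases img by (metis minus_minus)
qed

end

section \<open>The observability chain\<close>

definition obs_value :: "real \<Rightarrow> real^'n \<Rightarrow> real^'n^'n \<Rightarrow> real^'n \<Rightarrow> nat \<Rightarrow> real^'n \<Rightarrow> real" where
  "obs_value f c A e k \<xi> = obs_row c A k \<bullet> \<xi> + obs_offset f c A e k"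

lemma obs_value_0: "obs_value f c A e 0 \<xi> = c \<bullet> \<xi> + f"
  by (simp add: obs_value_def obs_row_def obs_offset_def)

text \<open>The index shift in \<open>obs_offset\<close> is made for this: differentiating the
  observation of order \<open>k\<close> along its own mode gives exactly the one of order
  \<open>Suc k\<close>.\<close>

lemma obs_row_field: "obs_row c A k \<bullet> (A *v \<xi> + e) = obs_value f c A e (Suc k) \<xi>"
  by (simp add: obs_value_def obs_row_def obs_offset_def inner_add_right
      vector_matrix_mul_assoc[symmetric] dot_lmul_matrix)

text \<open>Otherwise the extra row would raise the rank to \<open>h + 2\<close>, against the
  maximality of \<open>h\<close>.\<close>

lemma obs_row_Suc_in_span:
  assumes "c \<noteq> 0" and h: "observability_index c A = h"
  shows "obs_row c A (Suc h) \<in> span (obs_row c A ` {..h})"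
proof (rule ccontr)
  assume "obs_row c A (Suc h) \<notin> span (obs_row c A ` {..h})"
  then have "dim (obs_row c A ` {..Suc h}) = dim (obs_row c A ` {..h}) + 1"
    by (simp add: atMost_Suc dim_insert)
  then have "full_row_rank c A (Suc h)"
    using observability_index(1)[OF assms(1), of A] by (simp add: full_row_rank_def h)
  then show False
    using observability_index(2)[OF assms(1), of A] h by fastforce
qed

lemma span_inner_bound:
  fixes r :: "nat \<Rightarrow> 'a::real_inner"
  assumes "v \<in> span (r ` {..h})"
  shows "\<exists>B\<ge>0. \<forall>x. \<bar>v \<bullet> x\<bar> \<le> B * (\<Sum>j\<le>h. \<bar>r j \<bullet> x\<bar>)"
  using assms
proof (induction rule: span_induct_alt)
  case base
  then show ?case by (intro exI[of _ 0]) auto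
next
  case (step a w v)
  then obtain i B where i: "i \<le> h" "w = r i" and B: "B \<ge> 0"
    "\<And>x. \<bar>v \<bullet> x\<bar> \<le> B * (\<Sum>j\<le>h. \<bar>r j \<bullet> x\<bar>)" by auto
  have "\<bar>(a *\<^sub>R w + v) \<bullet> x\<bar> \<le> (\<bar>a\<bar> + B) * (\<Sum>j\<le>h. \<bar>r j \<bullet> x\<bar>)" for x
  proof -
    have "\<bar>w \<bullet> x\<bar> \<le> (\<Sum>j\<le>h. \<bar>r j \<bullet> x\<bar>)"
      unfolding i(2) using i(1) by (intro member_le_sum) auto
    then have "\<bar>a * (w \<bullet> x)\<bar> \<le> \<bar>a\<bar> * (\<Sum>j\<le>h. \<bar>r j \<bullet> x\<bar>)"
      by (auto simp: abs_mult intro: mult_left_mono)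
    then show ?thesis
      using B(2)[of x] by (simp add: inner_add_left algebra_simps)
  qed
  then show ?case using B(1) by (intro exI[of _ "\<bar>a\<bar> + B"]) auto
qed

text \<open>Relative to the common zero \<open>\<xi>\<^sub>0\<close> the offsets cancel and the
  observations become linear in \<open>\<xi> - \<xi>\<^sub>0\<close>, so the dependence of the last
  row on the earlier ones carries over to the values.\<close>

lemma obs_value_last_bound:
  assumes "c \<noteq> 0" "observability_index c A = h"
    and zero: "\<And>j. j \<le> Suc h \<Longrightarrow> obs_value f c A e j \<xi>\<^sub>0 = 0"
  shows "\<exists>B\<ge>0. \<forall>\<xi>. \<bar>obs_value f c A e (Suc h) \<xi>\<bar> \<le> B * (\<Sum>j<Suc h. \<bar>obs_value f c A e j \<xi>\<bar>)"
proof -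
  have val: "obs_value f c A e j \<xi> = obs_row c A j \<bullet> (\<xi> - \<xi>\<^sub>0)" if "j \<le> Suc h" for j \<xi>
    using zero[OF that] by (simp add: obs_value_def inner_diff_right)
  obtain B where B: "B \<ge> 0"
    "\<And>x. \<bar>obs_row c A (Suc h) \<bullet> x\<bar> \<le> B * (\<Sum>j\<le>h. \<bar>obs_row c A j \<bullet> x\<bar>)"
    using span_inner_bound[OF obs_row_Suc_in_span[OF assms(1,2)]] by auto
  show ?thesis
    using B(1) B(2)[of "\<xi> - \<xi>\<^sub>0" for \<xi>] by (intro exI[of _ B]) (auto simp: val lessThan_Suc_atMost)
qed

text \<open>Rows and offsets are related by the same \<open>M\<close>, hence so are the affine
  observations; triangularity cuts the sums off at \<open>i\<close>.\<close>

lemma obs_value_lower_triangular: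
  assumes M: "lower_triangular m M"
    and rows: "\<forall>i<m. obs_row c A1 i = (\<Sum>j<m. M i j *\<^sub>R obs_row c A2 j)"
    and offs: "\<forall>i<m. obs_offset f c A1 e1 i = (\<Sum>j<m. M i j * obs_offset f c A2 e2 j)"
    and i: "i < m"
  shows "obs_row c A1 i \<bullet> v = (\<Sum>j\<le>i. M i j * (obs_row c A2 j \<bullet> v))"
    and "obs_value f c A1 e1 i \<xi> = (\<Sum>j\<le>i. M i j * obs_value f c A2 e2 j \<xi>)"
proof -
  have restrict: "(\<Sum>j<m. M i j * g j) = (\<Sum>j\<le>i. M i j * g j)" for g
    by (rule sum.mono_neutral_right) (use M i in \<open>auto simp: lower_triangular_def not_le\<close>)
  have row: "obs_row c A1 i \<bullet> v = (\<Sum>j<m. M i j * (obs_row c A2 j \<bullet> v))" for v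
    using rows i by (simp add: inner_sum_left)
  show "obs_row c A1 i \<bullet> v = (\<Sum>j\<le>i. M i j * (obs_row c A2 j \<bullet> v))"
    using row restrict by simp
  show "obs_value f c A1 e1 i \<xi> = (\<Sum>j\<le>i. M i j * obs_value f c A2 e2 j \<xi>)"
    using row[of \<xi>] offs i restrict
    by (simp add: obs_value_def sum.distrib[symmetric] distrib_left[symmetric])
qed

text \<open>
  Comparing the derivatives along the first mode of both sides of \<open>W = M Z\<close>, where \<open>W\<close>, \<open>Z\<close> are
  the observed values of the two modes, gives
  \<open>\<Sum>\<^sub>j\<^sub>\<le>\<^sub>k M\<^sub>k\<^sub>j D\<^sub>j = \<Sum>\<^sub>j\<^sub>\<le>\<^sub>k\<^sub>+\<^sub>1 M\<^sub>k\<^sub>+\<^sub>1\<^sub>,\<^sub>j Z\<^sub>j\<close> for the derivatives \<open>D\<^sub>j\<close> of the \<open>Z\<^sub>j\<close>.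
\<close>

lemma obs_row_other_field:
  assumes M: "lower_triangular m M" and diag: "\<forall>i<m. M i i > 0"
    and rows: "\<forall>i<m. obs_row c A1 i = (\<Sum>j<m. M i j *\<^sub>R obs_row c A2 j)"
    and offs: "\<forall>i<m. obs_offset f c A1 e1 i = (\<Sum>j<m. M i j * obs_offset f c A2 e2 j)"
    and "Suc k < m"
  shows "\<exists>p>0. \<exists>C\<ge>0. \<forall>\<xi>. \<bar>obs_row c A2 k \<bullet> (A1 *v \<xi> + e1) - p * obs_value f c A2 e2 (Suc k) \<xi>\<bar>
    \<le> C * (\<Sum>i\<le>k. \<bar>obs_value f c A2 e2 i \<xi>\<bar>)"
  using assms(5)
proof (induction k rule: less_induct)
  case (less k)
  define Z where "Z = obs_value f c A2 e2"
  define D where "D j \<xi> = obs_row c A2 j \<bullet> (A1 *v \<xi> + e1)" for j \<xi>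
  define T where "T \<xi> = (\<Sum>i\<le>k. \<bar>Z i \<xi>\<bar>)" for \<xi>
  have T: "0 \<le> T \<xi>" for \<xi> by (auto simp: T_def intro: sum_nonneg)
  have Z_le: "\<bar>Z i \<xi>\<bar> \<le> T \<xi>" if "i \<le> k" for i \<xi>
    unfolding T_def using that by (intro member_le_sum) auto
  \<comment> \<open>By the induction hypothesis \<open>D j\<close> is close to a multiple of
    \<open>Z (Suc j)\<close>, and \<open>Suc j \<le> k\<close> places this term inside
    \<open>T\<close>.\<close>
  have "\<exists>L\<ge>0. \<forall>\<xi>. \<bar>D j \<xi>\<bar> \<le> L * T \<xi>" if j: "j < k" for j
  proof -
    have "Suc j < m" using j less.prems by simp
    from less.IH[OF j this] obtain p C where p: "p > 0" "C \<ge> 0"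
      and le: "\<And>\<xi>. \<bar>D j \<xi> - p * Z (Suc j) \<xi>\<bar> \<le> C * (\<Sum>i\<le>j. \<bar>Z i \<xi>\<bar>)"
      unfolding D_def Z_def by blast
    have "\<bar>D j \<xi>\<bar> \<le> (p + C) * T \<xi>" for \<xi>
    proof -
      have "(\<Sum>i\<le>j. \<bar>Z i \<xi>\<bar>) \<le> T \<xi>" unfolding T_def using j by (intro sum_mono2) auto
      then have 1: "C * (\<Sum>i\<le>j. \<bar>Z i \<xi>\<bar>) \<le> C * T \<xi>" using p by (intro mult_left_mono) auto
      have 2: "\<bar>p * Z (Suc j) \<xi>\<bar> \<le> p * T \<xi>"
        using p Z_le[of "Suc j" \<xi>] j by (auto simp: abs_mult)
      show ?thesis using 1 2 le[of \<xi>] by (simp add: algebra_simps abs_le_iff)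
    qed
    then show ?thesis using p by (intro exI[of _ "p + C"]) auto
  qed
  then obtain L where L: "\<And>j \<xi>. j < k \<Longrightarrow> \<bar>D j \<xi>\<bar> \<le> L j * T \<xi>" by metis
  have Mk: "M k k > 0" "M (Suc k) (Suc k) > 0" using diag less.prems by auto
  \<comment> \<open>Dividing by \<open>M k k\<close> isolates \<open>D k\<close>. What remains
    besides \<open>Z (Suc k)\<close> are entries of row \<open>Suc k\<close> and, weighted by the
    bounds on the earlier \<open>D j\<close>, entries of row \<open>k\<close>.\<close>
  define C where "C = ((\<Sum>j\<le>k. \<bar>M (Suc k) j\<bar>) + (\<Sum>j<k. \<bar>M k j\<bar> * \<bar>L j\<bar>)) / M k k"
  have C: "C \<ge> 0" using Mk by (auto simp: C_def intro!: divide_nonneg_pos add_nonneg_nonneg sum_nonneg)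
  have "\<bar>D k \<xi> - M (Suc k) (Suc k) / M k k * Z (Suc k) \<xi>\<bar> \<le> C * T \<xi>" for \<xi>
  proof -
    have "(\<Sum>j\<le>k. M k j * D j \<xi>) = obs_row c A1 k \<bullet> (A1 *v \<xi> + e1)"
      using obs_value_lower_triangular(1)[OF M rows offs, of k] less.prems by (simp add: D_def)
    also have "\<dots> = (\<Sum>j\<le>Suc k. M (Suc k) j * Z j \<xi>)"
      unfolding obs_row_field[where f = f] Z_def
      using obs_value_lower_triangular(2)[OF M rows offs less.prems] .
    finally have "M k k * D k \<xi> - M (Suc k) (Suc k) * Z (Suc k) \<xi> =
        (\<Sum>j\<le>k. M (Suc k) j * Z j \<xi>) - (\<Sum>j<k. M k j * D j \<xi>)"
      by (simp add: lessThan_Suc_atMost[symmetric])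
    also have "\<bar>\<dots>\<bar> \<le> (\<Sum>j\<le>k. \<bar>M (Suc k) j\<bar>) * T \<xi> + (\<Sum>j<k. \<bar>M k j\<bar> * \<bar>L j\<bar>) * T \<xi>"
    proof -
      have "\<bar>\<Sum>j\<le>k. M (Suc k) j * Z j \<xi>\<bar> \<le> (\<Sum>j\<le>k. \<bar>M (Suc k) j\<bar> * T \<xi>)"
        by (rule order_trans[OF sum_abs sum_mono]) (auto simp: abs_mult Z_le intro: mult_left_mono)
      moreover have "\<bar>\<Sum>j<k. M k j * D j \<xi>\<bar> \<le> (\<Sum>j<k. \<bar>M k j\<bar> * (\<bar>L j\<bar> * T \<xi>))"
      proof (rule order_trans[OF sum_abs sum_mono])
        fix j assume "j \<in> {..<k}"
        then have "\<bar>D j \<xi>\<bar> \<le> L j * T \<xi>" using L by simp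
        also have "\<dots> \<le> \<bar>L j\<bar> * T \<xi>" using T by (intro mult_right_mono) auto
        finally show "\<bar>M k j * D j \<xi>\<bar> \<le> \<bar>M k j\<bar> * (\<bar>L j\<bar> * T \<xi>)"
          by (auto simp: abs_mult intro: mult_left_mono)
      qed
      ultimately show ?thesis by (simp add: sum_distrib_right mult.assoc)
    qed
    also have "\<dots> = M k k * (C * T \<xi>)" using Mk by (simp add: C_def field_simps)
    finally have "M k k * \<bar>D k \<xi> - M (Suc k) (Suc k) / M k k * Z (Suc k) \<xi>\<bar> \<le> M k k * (C * T \<xi>)"
      using Mk by (simp add: abs_mult_pos' right_diff_distrib)
    then show ?thesis using Mk by simp
  qed
  then show ?case
    using Mk C unfolding D_def Z_def T_def
    by (intro exI[of _ "M (Suc k) (Suc k) / M k k"] conjI exI[of _ C]) auto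
qed

section \<open>Filippov solutions\<close>

text \<open>Off the switching hyperplane the velocity is an endpoint of the hull, so one formula
  covers all three regions; \<open>\<theta>\<close> is the weight of the second mode.\<close>

lemma G_mixture:
  assumes "v \<in> G A1 A2 e1 e2 c f \<xi>"
  obtains \<theta> where "0 \<le> \<theta>" "\<theta> \<le> 1" "v = (1 - \<theta>) *\<^sub>R (A1 *v \<xi> + e1) + \<theta> *\<^sub>R (A2 *v \<xi> + e2)"
proof -
  have "v \<in> convex hull {A1 *v \<xi> + e1, A2 *v \<xi> + e2}"
    using assms by (auto simp: G_def hull_inc split: if_splits)
  then obtain u w where "v = u *\<^sub>R (A1 *v \<xi> + e1) + w *\<^sub>R (A2 *v \<xi> + e2)" "0 \<le> u" "0 \<le> w" "u + w = 1"
    unfolding convex_hull_2 by blast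
  then show ?thesis using that[of w] by (simp add: eq_diff_eq[symmetric])
qed

lemma filippov_solution_negligible:
  assumes "filippov_solution A1 A2 e1 e2 c f \<xi> x"
  obtains N where "negligible N"
    "\<And>t. t \<notin> N \<Longrightarrow> \<exists>v \<in> G A1 A2 e1 e2 c f (x t). (x has_vector_derivative v) (at t)"
proof -
  have "AE t in lebesgue. \<exists>v \<in> G A1 A2 e1 e2 c f (x t). (x has_vector_derivative v) (at t)"
    using assms by (simp add: filippov_solution_def)
  then obtain N where "N \<in> null_sets lebesgue"
    "{t. \<not> (\<exists>v \<in> G A1 A2 e1 e2 c f (x t). (x has_vector_derivative v) (at t))} \<subseteq> N"
    by (auto simp: eventually_ae_filter)
  then show ?thesis using that[of N] by (auto simp: negligible_iff_null_sets)
qed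

text \<open>In each of the three cases \<open>G\<close> is a singleton along the solution; in the
  last one the hull collapses because the modes agree. A single mode thus holds almost everywhere,
  and by continuity of its field everywhere.\<close>

lemma non_switching_on_interval:
  fixes x :: "real \<Rightarrow> real^'n"
  assumes ac: "\<And>a b. absolutely_continuous_on_interval a b x" and N: "negligible N"
    and der: "\<And>t. t \<notin> N \<Longrightarrow> \<exists>v \<in> G A1 A2 e1 e2 c f (x t). (x has_vector_derivative v) (at t)"
    and cases: "(\<forall>t\<in>{l<..<u}. c \<bullet> x t + f > 0) \<or> (\<forall>t\<in>{l<..<u}. c \<bullet> x t + f < 0) \<or>
      (\<forall>t\<in>{l<..<u}. c \<bullet> x t + f = 0 \<and> A1 *v x t + e1 = A2 *v x t + e2)"
    and t: "t \<in> {l<..<u}"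
  shows "non_switching_time A1 A2 e1 e2 c f x t"
proof -
  have cont: "isCont (\<lambda>t. A *v x t + e) s" for A :: "real^'n^'n" and e s
  proof -
    have "continuous_on {s - 1..s + 1} x" using ac by (rule absolutely_continuous_imp_continuous_on)
    then have "isCont x s" by (rule continuous_on_interior) simp
    then show ?thesis
      by (intro continuous_intros bounded_linear.continuous[OF matrix_vector_mul_bounded_linear])
  qed
  have upgrade: "(x has_vector_derivative A *v x s + e) (at s)"
    if "\<And>s. s \<in> {l<..<u} - N \<Longrightarrow> G A1 A2 e1 e2 c f (x s) = {A *v x s + e}" "s \<in> {l<..<u}"
    for A :: "real^'n^'n" and e s
    by (rule absolutely_continuous_has_vector_derivative[OF ac N, of l s u "\<lambda>t. A *v x t + e"])
      (use that der cont in fastforce)+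
  have G_pos: "G A1 A2 e1 e2 c f \<xi> = {A2 *v \<xi> + e2}" if "c \<bullet> \<xi> + f > 0" for \<xi>
    using that by (simp add: G_def)
  define \<epsilon> where "\<epsilon> = min (t - l) (u - t)"
  have \<epsilon>: "\<epsilon> > 0" "\<And>s. s \<in> {t - \<epsilon><..<t + \<epsilon>} \<Longrightarrow> s \<in> {l<..<u}" using t by (auto simp: \<epsilon>_def)
  from cases show ?thesis
  proof (elim disjE)
    assume pos: "\<forall>t\<in>{l<..<u}. c \<bullet> x t + f > 0"
    have "(x has_vector_derivative A2 *v x s + e2) (at s)" if "s \<in> {l<..<u}" for s
      using that pos by (intro upgrade) (simp_all add: G_pos)
    then show ?thesis
      unfolding non_switching_time_def using \<epsilon> pos by (metis less_imp_le neg_le_0_iff_le)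
  next
    assume neg: "\<forall>t\<in>{l<..<u}. c \<bullet> x t + f < 0"
    have "(x has_vector_derivative A1 *v x s + e1) (at s)" if "s \<in> {l<..<u}" for s
      using that neg[rule_format] by (intro upgrade) (simp_all add: G_def)
    then show ?thesis
      unfolding non_switching_time_def using \<epsilon> neg by (metis less_imp_le)
  next
    assume zero: "\<forall>t\<in>{l<..<u}. c \<bullet> x t + f = 0 \<and> A1 *v x t + e1 = A2 *v x t + e2"
    have "(x has_vector_derivative A1 *v x s + e1) (at s)" if "s \<in> {l<..<u}" for s
      using that zero[rule_format] by (intro upgrade) (simp_all add: G_def)
    then show ?thesis
      unfolding non_switching_time_def using \<epsilon> zero by (metis order_refl)
  qed
qed

text \<open>The second mode differentiates \<open>Z k\<close> to exactly \<open>Z (Suc k)\<close>,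
  the first to \<open>p k * Z (Suc k)\<close> plus a controlled error. A mixture therefore has the
  positive factor \<open>(1 - \<theta>) * p k + \<theta>\<close>, and its error is scaled by
  \<open>1 - \<theta>\<close>.\<close>

lemma filippov_positive_chain:
  fixes x :: "real \<Rightarrow> real^'n"
  assumes ac: "\<And>a b. absolutely_continuous_on_interval a b x" and N: "negligible N"
    and der: "\<And>t. t \<notin> N \<Longrightarrow> \<exists>v \<in> G A1 A2 e1 e2 c f (x t). (x has_vector_derivative v) (at t)"
    and M: "lower_triangular (Suc n) M" and diag: "\<forall>i<Suc n. M i i > 0"
    and rows: "\<forall>i<Suc n. obs_row c A1 i = (\<Sum>j<Suc n. M i j *\<^sub>R obs_row c A2 j)"
    and offs: "\<forall>i<Suc n. obs_offset f c A1 e1 i = (\<Sum>j<Suc n. M i j * obs_offset f c A2 e2 j)"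
  shows "\<exists>p P C. positive_chain (\<lambda>j t. obs_value f c A2 e2 j (x t)) n N p P C"
proof -
  define Z where "Z = obs_value f c A2 e2"
  have "\<exists>p C. k < n \<longrightarrow> p > 0 \<and> C \<ge> 0 \<and> (\<forall>\<xi>. \<bar>obs_row c A2 k \<bullet> (A1 *v \<xi> + e1) - p * Z (Suc k) \<xi>\<bar>
    \<le> C * (\<Sum>i\<le>k. \<bar>Z i \<xi>\<bar>))" for k
    using obs_row_other_field[OF M diag rows offs, of k] unfolding Z_def by (metis not_less_eq)
  then obtain p C where pC: "\<And>k. k < n \<Longrightarrow> p k > 0" "\<And>k. k < n \<Longrightarrow> C k \<ge> 0"
    "\<And>k \<xi>. k < n \<Longrightarrow> \<bar>obs_row c A2 k \<bullet> (A1 *v \<xi> + e1) - p k * Z (Suc k) \<xi>\<bar> \<le> C k * (\<Sum>i\<le>k. \<bar>Z i \<xi>\<bar>)"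
    by metis
  \<comment> \<open>The value 1 is the factor of the second mode; with it included, every convex
    combination of \<open>p k\<close> and 1 lies between \<open>p0\<close> and
    \<open>P0\<close>.\<close>
  define p0 where "p0 = Min (insert 1 (p ` {..<n}))"
  define P0 where "P0 = Max (insert 1 (p ` {..<n}))"
  define C0 where "C0 = (\<Sum>k<n. C k)"
  have p0: "p0 > 0" "p0 \<le> 1" "\<And>k. k < n \<Longrightarrow> p0 \<le> p k" using pC(1) by (auto simp: p0_def)
  have P0: "1 \<le> P0" "\<And>k. k < n \<Longrightarrow> p k \<le> P0" by (auto simp: P0_def)
  have C0: "C0 \<ge> 0" "\<And>k. k < n \<Longrightarrow> C k \<le> C0"
    using pC(2) by (auto simp: C0_def intro!: sum_nonneg member_le_sum)
  have "positive_chain (\<lambda>j t. Z j (x t)) n N p0 P0 C0"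
  proof
    show "absolutely_continuous_on_interval a b (\<lambda>t. Z j (x t))" for a b j
    proof (rule absolutely_continuous_dominated[OF ac, of "norm (obs_row c A2 j)" 0])
      show "norm (Z j (x v) - Z j (x u)) \<le> norm (obs_row c A2 j) * norm (x v - x u) + 0 * (v - u)" for u v
        using Cauchy_Schwarz_ineq2[of "obs_row c A2 j" "x v - x u"]
        by (simp add: Z_def obs_value_def inner_diff_right)
    qed auto
    fix t k assume t: "t \<notin> N" and k: "k < n"
    from der[OF t] obtain v where v: "v \<in> G A1 A2 e1 e2 c f (x t)" "(x has_vector_derivative v) (at t)"
      by blast
    from v(1) obtain \<theta> where \<theta>: "0 \<le> \<theta>" "\<theta> \<le> 1"
      and v_eq: "v = (1 - \<theta>) *\<^sub>R (A1 *v x t + e1) + \<theta> *\<^sub>R (A2 *v x t + e2)"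
      by (rule G_mixture)
    define D where "D = obs_row c A2 k \<bullet> (A1 *v x t + e1)"
    have "((\<lambda>t. obs_row c A2 k \<bullet> x t) has_vector_derivative obs_row c A2 k \<bullet> v) (at t)"
      by (rule bounded_linear.has_vector_derivative[OF bounded_linear_inner_right v(2)])
    then have d: "((\<lambda>t. Z k (x t)) has_real_derivative obs_row c A2 k \<bullet> v) (at t)"
      unfolding Z_def obs_value_def has_real_derivative_iff_has_vector_derivative
      by (intro has_vector_derivative_add_const[THEN iffD2])
    define q where "q = (1 - \<theta>) * p k + \<theta>"
    have "(1 - \<theta>) * p0 + \<theta> * p0 \<le> q" "q \<le> (1 - \<theta>) * P0 + \<theta> * P0"
      unfolding q_def using \<theta> p0 P0 k
      by (intro add_mono mult_left_mono mult_left_le[of p0 \<theta>] mult_left_mono[of 1 P0 \<theta>, simplified]; simp)+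
    then have q: "p0 \<le> q" "q \<le> P0" by (simp_all add: algebra_simps)
    have S: "0 \<le> (\<Sum>i\<le>k. \<bar>Z i (x t)\<bar>)" by (auto intro: sum_nonneg)
    have "obs_row c A2 k \<bullet> v = (1 - \<theta>) * D + \<theta> * (obs_row c A2 k \<bullet> (A2 *v x t + e2))"
      unfolding v_eq D_def inner_add_right[of _ "(1 - \<theta>) *\<^sub>R _"] by simp
    also have "obs_row c A2 k \<bullet> (A2 *v x t + e2) = Z (Suc k) (x t)"
      unfolding Z_def by (rule obs_row_field)
    finally have "obs_row c A2 k \<bullet> v - q * Z (Suc k) (x t) = (1 - \<theta>) * (D - p k * Z (Suc k) (x t))"
      by (simp add: q_def algebra_simps)
    then have "\<bar>obs_row c A2 k \<bullet> v - q * Z (Suc k) (x t)\<bar> = (1 - \<theta>) * \<bar>D - p k * Z (Suc k) (x t)\<bar>"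
      using \<theta> by (simp add: abs_mult)
    also have "\<dots> \<le> 1 * (C0 * (\<Sum>i\<le>k. \<bar>Z i (x t)\<bar>))"
    proof (rule mult_mono)
      have "\<bar>D - p k * Z (Suc k) (x t)\<bar> \<le> C k * (\<Sum>i\<le>k. \<bar>Z i (x t)\<bar>)"
        unfolding D_def by (rule pC(3)[OF k])
      also have "\<dots> \<le> C0 * (\<Sum>i\<le>k. \<bar>Z i (x t)\<bar>)"
        using C0(2)[OF k] S by (rule mult_right_mono)
      finally show "\<bar>D - p k * Z (Suc k) (x t)\<bar> \<le> C0 * (\<Sum>i\<le>k. \<bar>Z i (x t)\<bar>)" .
    qed (use \<theta> in auto)
    finally show "\<exists>d q. ((\<lambda>t. Z k (x t)) has_real_derivative d) (at t) \<and> p0 \<le> q \<and> q \<le> P0 \<and>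
        \<bar>d - q * Z (Suc k) (x t)\<bar> \<le> C0 * (\<Sum>i\<le>k. \<bar>Z i (x t)\<bar>)"
      using d q by (intro exI[of _ "obs_row c A2 k \<bullet> v"] exI[of _ q]) simp
  qed (use N p0 P0 C0 in auto)
  then show ?thesis unfolding Z_def by blast
qed

section \<open>Excluding accumulation of switching times on either side\<close>

theorem theorem4p1:
  fixes A1 A2 :: "real^'n^'n" and e1 e2 c :: "real^'n" and f :: real and h :: nat
  assumes "c \<noteq> 0"
    and "observability_index c A1 = h"
    and "observability_index c A2 = h"
    and "\<exists>M :: nat \<Rightarrow> nat \<Rightarrow> real.
           lower_triangular (h + 2) M \<and> (\<forall>i<h + 2. M i i > 0) \<and>
           (\<forall>i<h + 2. obs_row c A1 i = (\<Sum>j<h + 2. M i j *\<^sub>R obs_row c A2 j)) \<and>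
           (\<forall>i<h + 2. obs_offset f c A1 e1 i = (\<Sum>j<h + 2. M i j * obs_offset f c A2 e2 j))"
    and "\<And>\<xi> :: real^'n. (\<forall>i<h + 2. obs_row c A1 i \<bullet> \<xi> + obs_offset f c A1 e1 i = 0) \<Longrightarrow>
           A1 *v \<xi> + e1 = A2 *v \<xi> + e2"
  shows "Zeno_free A1 A2 e1 e2 c f"
proof -
  have h2: "h + 2 = Suc (Suc h)" by simp
  obtain M where M: "lower_triangular (Suc (Suc h)) M" "\<forall>i<Suc (Suc h). M i i > 0"
    "\<forall>i<Suc (Suc h). obs_row c A1 i = (\<Sum>j<Suc (Suc h). M i j *\<^sub>R obs_row c A2 j)"
    "\<forall>i<Suc (Suc h). obs_offset f c A1 e1 i = (\<Sum>j<Suc (Suc h). M i j * obs_offset f c A2 e2 j)"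
    using assms(4) unfolding h2 by blast
  \<comment> \<open>Through \<open>M\<close>, vanishing second-mode observations force the
    first-mode ones to vanish, which is the premise of the assumed implication.\<close>
  have vanish: "A1 *v \<xi> + e1 = A2 *v \<xi> + e2" if "\<And>j. j \<le> Suc h \<Longrightarrow> obs_value f c A2 e2 j \<xi> = 0" for \<xi>
  proof (rule assms(5), intro allI impI)
    fix i assume "i < h + 2"
    then show "obs_row c A1 i \<bullet> \<xi> + obs_offset f c A1 e1 i = 0"
      using obs_value_lower_triangular(2)[OF M(1,3,4), of i \<xi>] that
      by (simp add: obs_value_def)
  qed
  have zeno: "\<not> left_Zeno_time A1 A2 e1 e2 c f x s \<and> \<not> right_Zeno_time A1 A2 e1 e2 c f x s"
    if sol: "filippov_solution A1 A2 e1 e2 c f \<xi> x" for \<xi> x s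
  proof -
    have x_ac: "absolutely_continuous_on_interval a b x" for a b
      using sol by (simp add: filippov_solution_def)
    obtain N where x_der: "negligible N"
      "\<And>t. t \<notin> N \<Longrightarrow> \<exists>v \<in> G A1 A2 e1 e2 c f (x t). (x has_vector_derivative v) (at t)"
      using filippov_solution_negligible[OF sol] by blast
    \<comment> \<open>The \<open>h + 2\<close> rows are indexed from 0, so the last function of the
      chain is \<open>Suc h\<close>.\<close>
    obtain p P C where "positive_chain (\<lambda>j t. obs_value f c A2 e2 j (x t)) (Suc h) N p P C"
      using filippov_positive_chain[OF x_ac x_der M] by blast
    then interpret positive_chain "\<lambda>j t. obs_value f c A2 e2 j (x t)" "Suc h" N p P C .
    have B: "\<exists>B\<ge>0. \<forall>t. \<bar>obs_value f c A2 e2 (Suc h) (x t)\<bar> \<le> B * (\<Sum>j<Suc h. \<bar>obs_value f c A2 e2 j (x t)\<bar>)"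
      if "\<And>j. j \<le> Suc h \<Longrightarrow> obs_value f c A2 e2 j (x s) = 0"
      using obs_value_last_bound[OF assms(1,3) that] by blast
    obtain \<epsilon> where \<epsilon>: "\<epsilon> > 0" "(\<forall>t\<in>{s<..<s + \<epsilon>}. obs_value f c A2 e2 0 (x t) > 0) \<or>
      (\<forall>t\<in>{s<..<s + \<epsilon>}. obs_value f c A2 e2 0 (x t) < 0) \<or> (\<forall>t\<in>{s<..<s + \<epsilon>}. \<forall>j\<le>Suc h. obs_value f c A2 e2 j (x t) = 0)"
      using trichotomy_right[OF zero_less_Suc, of s] B by blast
    have "(\<forall>t\<in>{s<..<s + \<epsilon>}. c \<bullet> x t + f > 0) \<or> (\<forall>t\<in>{s<..<s + \<epsilon>}. c \<bullet> x t + f < 0) \<or>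
      (\<forall>t\<in>{s<..<s + \<epsilon>}. c \<bullet> x t + f = 0 \<and> A1 *v x t + e1 = A2 *v x t + e2)"
      using \<epsilon>(2) vanish by (metis obs_value_0 zero_le)
    \<comment> \<open>A left Zeno time is approached by switching times from the right, hence the
      right-hand trichotomy excludes it.\<close>
    then have right: "\<not> left_Zeno_time A1 A2 e1 e2 c f x s"
      using non_switching_on_interval[OF x_ac x_der] \<epsilon>(1) unfolding left_Zeno_time_def by metis
    obtain \<epsilon> where \<epsilon>: "\<epsilon> > 0" "(\<forall>t\<in>{s - \<epsilon><..<s}. obs_value f c A2 e2 0 (x t) > 0) \<or>
      (\<forall>t\<in>{s - \<epsilon><..<s}. obs_value f c A2 e2 0 (x t) < 0) \<or> (\<forall>t\<in>{s - \<epsilon><..<s}. \<forall>j\<le>Suc h. obs_value f c A2 e2 j (x t) = 0)"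
      using trichotomy_left[OF zero_less_Suc, of s] B by blast
    have "(\<forall>t\<in>{s - \<epsilon><..<s}. c \<bullet> x t + f > 0) \<or> (\<forall>t\<in>{s - \<epsilon><..<s}. c \<bullet> x t + f < 0) \<or>
      (\<forall>t\<in>{s - \<epsilon><..<s}. c \<bullet> x t + f = 0 \<and> A1 *v x t + e1 = A2 *v x t + e2)"
      using \<epsilon>(2) vanish by (metis obs_value_0 zero_le)
    then have "\<not> right_Zeno_time A1 A2 e1 e2 c f x s"
      using non_switching_on_interval[OF x_ac x_der] \<epsilon>(1) unfolding right_Zeno_time_def by metis
    with right show ?thesis by blast
  qed
  then show ?thesis
    unfolding Zeno_free_def left_Zeno_free_def right_Zeno_free_def by blast
qed

end
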